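(* Consider the distributed stochastic optimization setting described in the context: the problem $\min_{\theta\in\Omega} f(\theta)=\sum_{i=1}^N f_i(\theta)$, the communication graph with weight matrix $A$, the noises $\xi_{i,k}$ with constants $\delta\in(1,2]$ and $\nu>0$, the gradient bound $C_0>0$, and the iterates $x_{i,k}$ generated by the clipped distributed stochastic gradient projection algorithm with positive step-sizes $\alpha_k$ and positive clipping thresholds $\tau_k$. Let $\mu=0$ if the $f_i$, $i=1,\dots,N$, are (merely) convex, and let $\mu>0$ if every $f_i$, $i=1,\dots,N$, is $\mu$-strongly convex. Suppose that the sequence $(\alpha_k)_{k\ge0}$ is decreasing, the sequence $(\tau_k)_{k\ge 0}$ is increasing, and that (1) there is a $k_1>0$ such that $\tau_k\ge 2C_0$ for all $k\ge k_1$; (2) $\sum_{k=0}^{+\infty}\alpha_k=\infty$ and $\sum_{k=0}^{+\infty}\alpha_k^2<+\infty$; (3) $\lim_{k\to+\infty}\alpha_k\tau_k=0$ and $\sum_{k=0}^{+\infty}\alpha_k^2\tau_k^2<+\infty$; (4) there exist constants $\omega>0$ and $\varpi\in\mathbb{R}$ such that $$\sum_{k=0}^{+\infty}\left(\omega\alpha_k^{\varpi}-\mu\alpha_k\right)<+\infty,\qquad \sum_{k=0}^{+\infty}\alpha_k^{2-\varpi}\tau_k^{2-2\delta}<+\infty .$$ Then, with probability 1, for every $i\in\{1,\dots,N\}$, $x_{i,k}$ converges as $k\to+\infty$ to a vector in the optimal solution set $\Omega^*$.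
   Context: Problem. $N>1$ agents cooperate to solve $\min_{\theta\in\Omega} f(\theta)=\sum_{i=1}^N f_i(\theta)$, where $\Omega\subset\mathbb{R}^n$ and $f_i$ is the real-valued local objective of agent $i$. $\Omega^*$ denotes the set of minimizers of $f$ over $\Omega$. $\Vert\cdot\Vert$ is the Euclidean norm and $\mathbb{P}_\Omega$ the Euclidean projection onto $\Omega$. Standing assumptions. (A1) The agents communicate over a directed graph $\mathcal{G}_N$ with node set $\mathcal{V}_N=\{1,\dots,N\}$ and $N\times N$ nonnegative weight matrix $A$, where $[A]_{i,j}$ is the weight of the edge from $j$ to $i$. $\mathcal{N}_i$ is the set of agents whose states are available to agent $i$; $i\in\mathcal{N}_i$, and $j\in\mathcal{N}_i$ if and only if $[A]_{i,j}>0$. $\mathcal{G}_N$ is strongly connected (there is a directed path from any node to any other node). $A$ is doubly stochastic: $\sum_{i=1}^N[A]_{i,j}=\sum_{j=1}^N[A]_{i,j}=1$. There is $0<\eta<1$ with $[A]_{i,j}\ge\eta$ whenever $j\in\mathcal{N}_i$. (A2) Each $f_i$ is continuously differentiable and convex on $\Omega$. (A3) $\Omega$ is nonempty, closed and convex, and there is $C_0>0$ with $\Vert\nabla f_i(\theta)\Vert\le C_0$ for all $\theta\in\Omega$ and all $i$. (A4) $\Omega^*\neq\emptyset$. Algorithm. Given (deterministic) initial points $x_{i,0}\in\Omega$, for $k=0,1,2,\dots$ and $i\in\mathcal{V}_N$, $$v_{i,k}=\sum_{j=1}^N[A]_{i,j}x_{j,k},\qquad g_{i,k}=\nabla f_i(v_{i,k})+\xi_{i,k},$$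 $$\hat g_{i,k}=\min\left\{1,\frac{\tau_k}{\Vert g_{i,k}\Vert}\right\}g_{i,k},\qquad x_{i,k+1}=\mathbb{P}_\Omega\left[v_{i,k}-\alpha_k\hat g_{i,k}\right],$$ (with $\hat g_{i,k}=0$ when $g_{i,k}=0$), where $\alpha_k,\tau_k>0$ are deterministic sequences and $\xi_{i,k}$ is an $\mathbb{R}^n$-valued random noise. Noise assumptions. Let $\mathcal{F}_k=\sigma(\xi_{i,m};\ i\in\mathcal{V}_N,\ m=0,\dots,k-1)$. (A5) There exist $\delta\in(1,2]$ and $\nu>0$ such that $\mathbb{E}[\Vert\xi_{i,k}\Vert^\delta\mid\mathcal{F}_k]\le\nu^\delta$ with probability 1, for all $i,k$. (A6) $\mathbb{E}[\xi_{i,k}\mid\mathcal{F}_k]=0$ with probability 1, for all $i,k$. Strong convexity. A function $h$ is $\mu$-strongly convex ($\mu>0$) if for all $x,y\in\mathbb{R}^n$, $h(y)-h(x)\ge\nabla h(x)^\top(y-x)+\frac{\mu}{2}\Vert y-x\Vert^2$. *)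

theory Defs
  imports "HOL-Probability.Probability"
begin

definition gradient :: "('a::real_inner \<Rightarrow> real) \<Rightarrow> 'a \<Rightarrow> 'a" where
  "gradient h x = (THE D. GDERIV h x :> D)"

lemma GDERIV_gradient:
  fixes h :: "'a::euclidean_space \<Rightarrow> real"
  assumes "h differentiable (at x)"
  shows "GDERIV h x :> gradient h x"
proof -
  obtain h' where h': "(h has_derivative h') (at x)"
    using assms by (auto simp: differentiable_def)
  then have lin: "linear h'" by (rule has_derivative_linear)
  have "h' = (\<lambda>y. y \<bullet> adjoint h' 1)"
  proof
    show "h' y = y \<bullet> adjoint h' 1" for y
      using adjoint_works[OF lin, of y 1] by simp
  qed
  with h' have ex: "GDERIV h x :> adjoint h' 1"
    unfolding gderiv_def by (rule has_derivative_eq_rhs)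
  have "D = adjoint h' 1" if "GDERIV h x :> D" for D
  proof -
    have "(\<lambda>y. y \<bullet> D) = (\<lambda>y. y \<bullet> adjoint h' 1)"
      using that ex unfolding gderiv_def by (rule has_derivative_unique)
    then have "\<forall>y. y \<bullet> D = y \<bullet> adjoint h' 1"
      by (simp add: fun_eq_iff)
    then show ?thesis by (simp only: vector_eq_ldot)
  qed
  with ex show ?thesis unfolding gradient_def by (rule theI)
qed

definition strongly_convex :: "real \<Rightarrow> ('a::real_inner \<Rightarrow> real) \<Rightarrow> bool" where
  "strongly_convex \<mu> h \<longleftrightarrow>
     0 < \<mu> \<and> (\<forall>x. h differentiable (at x)) \<and>
     (\<forall>x y. h y - h x \<ge> gradient h x \<bullet> (y - x) + \<mu> / 2 * (norm (y - x))\<^sup>2)"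

definition minimizers :: "'a set \<Rightarrow> ('a \<Rightarrow> real) \<Rightarrow> 'a set" where
  "minimizers S h = {\<theta> \<in> S. \<forall>\<theta>'\<in>S. h \<theta> \<le> h \<theta>'}"

text \<open>
  The entry \<open>A $ i $ j\<close> is the weight of the edge from \<open>j\<close> to \<open>i\<close>.
\<close>

definition in_neighbours :: "real ^ 'a ^ 'a \<Rightarrow> 'a \<Rightarrow> 'a set" where
  "in_neighbours A i = {j. A $ i $ j > 0}"

definition edges :: "real ^ 'a ^ 'a \<Rightarrow> ('a \<times> 'a) set" where
  "edges A = {(j, i). j \<in> in_neighbours A i}"

definition strongly_connected :: "real ^ 'a ^ 'a \<Rightarrow> bool" where
  "strongly_connected A \<longleftrightarrow> (\<forall>i j. (i, j) \<in> (edges A)\<^sup>*)"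

definition doubly_stochastic :: "real ^ 'a ^ 'a \<Rightarrow> bool" where
  "doubly_stochastic A \<longleftrightarrow>
     (\<forall>i j. A $ i $ j \<ge> 0) \<and>
     (\<forall>j. (\<Sum>i\<in>UNIV. A $ i $ j) = 1) \<and> (\<forall>i. (\<Sum>j\<in>UNIV. A $ i $ j) = 1)"

text \<open>Since \<open>\<tau> / 0 = 0\<close>, clipping maps \<open>0\<close> to \<open>0\<close>.\<close>

definition clip :: "real \<Rightarrow> 'a::real_normed_vector \<Rightarrow> 'a" where
  "clip \<tau> g = min 1 (\<tau> / norm g) *\<^sub>R g"

text \<open>
  The \<open>\<sigma>\<close>-algebra generated by the noises of all agents strictly before time \<open>k\<close>; it is the
  trivial \<open>\<sigma>\<close>-algebra for \<open>k = 0\<close>.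
\<close>

definition noise_past ::
    "'w measure \<Rightarrow> ('a \<Rightarrow> nat \<Rightarrow> 'w \<Rightarrow> 'b::topological_space) \<Rightarrow> nat \<Rightarrow> 'w measure" where
  "noise_past M \<xi> k =
     sigma (space M) {\<xi> i m -` B \<inter> space M | i m B. m < k \<and> B \<in> sets borel}"

definition vec_cond_exp ::
    "'w measure \<Rightarrow> 'w measure \<Rightarrow> ('w \<Rightarrow> real ^ 'n) \<Rightarrow> 'w \<Rightarrow> real ^ 'n" where
  "vec_cond_exp M F X w = (\<chi> c. real_cond_exp M F (\<lambda>w'. X w' $ c) w)"

text \<open>
  The series has a value in \<open>[-\<infinity>, \<infinity>)\<close>; its terms may be negative and divergence to \<open>-\<infinity>\<close>
  is allowed.
\<close>

definition series_less_infinity :: "(nat \<Rightarrow> real) \<Rightarrow> bool" where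
  "series_less_infinity a \<longleftrightarrow>
     (\<exists>S::ereal. S < \<infinity> \<and> (\<lambda>n. ereal (\<Sum>k<n. a k)) \<longlonglongrightarrow> S)"

end

theory Submission
  imports Defs
begin

text \<open>
  Clipping is inactive unless the noise exceeds \<open>\<tau> / 2\<close>, so the clipped gradient differs from the noisy
  one by at most \<open>(\<tau> / 2)\<^bsup>1 - \<delta>\<^esup> \<parallel>\<xi>\<parallel>\<^sup>\<delta>\<close>, and its conditional bias is \<open>O(\<tau>\<^bsup>1 - \<delta>\<^esup>)\<close>. By Young's inequality
  with weight \<open>\<omega> \<alpha>\<^sup>\<varpi>\<close>, part of the bias is absorbed by strong convexity and the rest is summable.
  The disagreement of the agents contracts geometrically and is perturbed by at most \<open>O(\<alpha> \<tau>)\<close>, which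
  bounds it by a deterministic sequence \<open>D\<close> with \<open>\<Sum> \<alpha> D < \<infinity>\<close>. Hence, for each minimizer \<open>\<theta>\<close>, the sum of
  \<open>\<parallel>x\<^sub>i - \<theta>\<parallel>\<^sup>2\<close> over the agents is an almost supermartingale. Its martingale part is bounded in
  \<open>L\<^sup>2\<close> because the clipped gradients are bounded by \<open>\<tau>\<close> and \<open>\<Sum> \<alpha>\<^sup>2 \<tau>\<^sup>2 < \<infinity>\<close>, so Kolmogorov's maximal
  inequality gives almost sure convergence without upcrossings. Doing this for a countable dense set of
  minimizers, a Fejer argument identifies the limit.
\<close>

section \<open>Convergence of square-integrable martingales\<close>

text \<open>The noise may have infinite variance and \<open>\<Omega>\<close> may be unbounded, so
  the distance to a minimizer \<open>\<theta>\<close> has no a priori bound uniform in time; yet it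
  multiplies both error terms. For the martingale part, the variance at time \<open>k\<close> is
  bounded by \<open>\<alpha>^2 * \<tau>^2\<close> times the Lyapunov value itself. This circle is
  broken by taking expectations first: the martingale part drops out, a Gronwall argument bounds the
  mean Lyapunov value, and only then are the variances summable. For the bias, Young's inequality
  leaves the squared distance with coefficient \<open>p - \<mu> * \<alpha> k\<close>, where
  \<open>p = \<omega> * \<alpha> k powr \<omega>'\<close>. Only its positive part may serve as a
  growth rate, and the summability of that part has to be extracted from a series that is allowed to
  diverge to minus infinity. A further mismatch is that the gradients are taken at different points
  for different agents, whereas optimality concerns the sum of the objectives at one point. Passing
  to the mean of the agents costs a multiple of \<open>\<alpha> k * D k\<close>.\<close>

lemma (in prob_space) orthogonal_sum_square:
  fixes Y :: "nat \<Rightarrow> 'a \<Rightarrow> real"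
  assumes sub: "\<And>k. subalgebra M (F k)" and filt: "\<And>k. subalgebra (F (Suc k)) (F k)"
    and Y[measurable]: "\<And>k. Y k \<in> borel_measurable (F (Suc k))"
    and sq: "\<And>k. integrable M (\<lambda>w. (Y k w)\<^sup>2)"
    and mg: "\<And>k. AE w in M. real_cond_exp M (F k) (Y k) w = 0"
  shows "(\<lambda>w. \<Sum>k<n. Y k w) \<in> borel_measurable (F n)"
    and "integrable M (\<lambda>w. (\<Sum>k<n. Y k w)\<^sup>2)"
    and "expectation (\<lambda>w. (\<Sum>k<n. Y k w)\<^sup>2) = (\<Sum>k<n. expectation (\<lambda>w. (Y k w)\<^sup>2))"
proof -
  have meas: "(\<lambda>w. \<Sum>k<n. Y k w) \<in> borel_measurable (F n)" for n
  proof (induction n)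
    case (Suc n)
    note measurable_from_subalg[OF filt Suc, measurable]
    show ?case by simp
  qed simp
  then show "(\<lambda>w. \<Sum>k<n. Y k w) \<in> borel_measurable (F n)" .
  have "integrable M (\<lambda>w. (\<Sum>k<n. Y k w)\<^sup>2) \<and>
    expectation (\<lambda>w. (\<Sum>k<n. Y k w)\<^sup>2) = (\<Sum>k<n. expectation (\<lambda>w. (Y k w)\<^sup>2))"
  proof (induction n)
    case (Suc n)
    define T where "T = (\<lambda>w. \<Sum>k<n. Y k w)"
    interpret S: finite_measure_subalgebra M "F n"
      by unfold_locales (rule sub)
    have TF[measurable]: "T \<in> borel_measurable (F n)" unfolding T_def by (rule meas)
    have TM[measurable]: "T \<in> borel_measurable M" by (rule measurable_from_subalg[OF sub TF])
    have YM[measurable]: "Y n \<in> borel_measurable M" by (rule measurable_from_subalg[OF sub Y])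
    have T2: "integrable M (\<lambda>w. (T w)\<^sup>2)" using Suc T_def by simp
    have int: "integrable M (\<lambda>w. T w * Y n w)"
    proof (rule Bochner_Integration.integrable_bound)
      show "integrable M (\<lambda>w. (T w)\<^sup>2 + (Y n w)\<^sup>2)" using T2 sq by simp
      show "AE w in M. norm (T w * Y n w) \<le> norm ((T w)\<^sup>2 + (Y n w)\<^sup>2)"
      proof (rule AE_I2)
        fix w
        have "2 * \<bar>T w\<bar> * \<bar>Y n w\<bar> \<le> (T w)\<^sup>2 + (Y n w)\<^sup>2"
          using sum_squares_bound[of "\<bar>T w\<bar>" "\<bar>Y n w\<bar>"] by simp
        moreover have "0 \<le> \<bar>T w\<bar> * \<bar>Y n w\<bar>" by simp
        ultimately show "norm (T w * Y n w) \<le> norm ((T w)\<^sup>2 + (Y n w)\<^sup>2)"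
          unfolding real_norm_def abs_mult by linarith
      qed
    qed simp
    \<comment> \<open>\<open>T\<close> is known at time \<open>n\<close>, so \<open>Y n\<close> may
      be replaced by its conditional expectation, which is 0: the cross term of the square
      vanishes.\<close>
    have "expectation (\<lambda>w. T w * Y n w) = expectation (\<lambda>w. T w * real_cond_exp M (F n) (Y n) w)"
      by (rule S.real_cond_exp_intg(2)[OF int, symmetric]) auto
    also have "\<dots> = expectation (\<lambda>w. 0)"
      by (rule integral_cong_AE) (use mg[of n] measurable_from_subalg[OF sub borel_measurable_cond_exp] in auto)
    finally have orth: "expectation (\<lambda>w. T w * Y n w) = 0" by simp
    have eq: "(\<Sum>k<Suc n. Y k w)\<^sup>2 = (T w)\<^sup>2 + 2 * (T w * Y n w) + (Y n w)\<^sup>2" for w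
      by (simp add: T_def power2_eq_square algebra_simps)
    show ?case unfolding eq using T2 int sq orth Suc by (simp add: T_def)
  qed simp
  then show "integrable M (\<lambda>w. (\<Sum>k<n. Y k w)\<^sup>2)"
    and "expectation (\<lambda>w. (\<Sum>k<n. Y k w)\<^sup>2) = (\<Sum>k<n. expectation (\<lambda>w. (Y k w)\<^sup>2))"
    by auto
qed

text \<open>Stopping the sums at the first exit reduces the maximum to the value at the fixed time
  \<open>N\<close>, where Chebyshev's inequality applies; stopping keeps the increments orthogonal
  and only decreases their variances.\<close>

lemma (in prob_space) kolmogorov_maximal_finite:
  fixes Y :: "nat \<Rightarrow> 'a \<Rightarrow> real"
  assumes sub: "\<And>k. subalgebra M (F k)" and filt: "\<And>k. subalgebra (F (Suc k)) (F k)"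
    and Y[measurable]: "\<And>k. Y k \<in> borel_measurable (F (Suc k))"
    and sq: "\<And>k. integrable M (\<lambda>w. (Y k w)\<^sup>2)"
    and mg: "\<And>k. AE w in M. real_cond_exp M (F k) (Y k) w = 0"
    and eps: "0 < \<epsilon>"
  shows "prob {w\<in>space M. \<exists>n\<le>N. \<epsilon> \<le> \<bar>\<Sum>k<n. Y k w\<bar>} \<le> (\<Sum>k<N. expectation (\<lambda>w. (Y k w)\<^sup>2)) / \<epsilon>\<^sup>2"
proof -
  define S where "S = (\<lambda>n w. \<Sum>k<n. Y k w)"
  define B where "B = (\<lambda>k w. if \<forall>j\<in>{..k}. \<bar>S j w\<bar> < \<epsilon> then 1 else 0 :: real)"
  \<comment> \<open>The partial sums of \<open>Z\<close> are those of \<open>Y\<close>, stopped when they first leave \<open>(-\<epsilon>, \<epsilon>)\<close>.\<close>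
  define Z where "Z = (\<lambda>k w. B k w * Y k w)"
  have mono: "subalgebra (F k) (F j)" if "j \<le> k" for j k
    using that
  proof (induction k)
    case (Suc k)
    then show ?case using filt[of k] by (cases "j = Suc k") (auto simp: subalgebra_def le_Suc_eq)
  qed (simp add: subalgebra_def)
  have SF: "S n \<in> borel_measurable (F n)" for n
    unfolding S_def by (rule orthogonal_sum_square(1)[where F=F and Y=Y, OF sub filt Y sq mg])
  have SFk: "S j \<in> borel_measurable (F k)" if "j \<le> k" for j k
    by (rule measurable_from_subalg[OF mono[OF that] SF])
  have SM[measurable]: "S n \<in> borel_measurable M" for n
    by (rule measurable_from_subalg[OF sub SF])
  have YM[measurable]: "Y n \<in> borel_measurable M" for n
    by (rule measurable_from_subalg[OF sub Y])
  \<comment> \<open>The decision to stop before adding \<open>Y k\<close> uses the sums up to index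
    \<open>k\<close> only. This predictability lets \<open>B k\<close> be pulled out of the
    conditional expectation given \<open>F k\<close>.\<close>
  have BF[measurable]: "B k \<in> borel_measurable (F k)" for k
  proof -
    have "{w\<in>space (F k). \<forall>j\<in>{..k}. \<bar>S j w\<bar> < \<epsilon>} \<in> sets (F k)"
    proof (rule sets.sets_Collect_finite_All)
      fix j assume "j \<in> {..k}"
      then show "{w\<in>space (F k). \<bar>S j w\<bar> < \<epsilon>} \<in> sets (F k)"
        by (intro borel_measurable_less[OF borel_measurable_abs[OF SFk]] borel_measurable_const) simp
    qed auto
    then show ?thesis unfolding B_def by (intro measurable_If borel_measurable_const)
  qed
  have BS: "B k \<in> borel_measurable (F (Suc k))" for k by (rule measurable_from_subalg[OF filt BF])
  have BM[measurable]: "B k \<in> borel_measurable M" for k by (rule measurable_from_subalg[OF sub BF])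
  have ZF: "Z k \<in> borel_measurable (F (Suc k))" for k
    unfolding Z_def using BS by measurable
  have Zle: "(Z k w)\<^sup>2 \<le> (Y k w)\<^sup>2" for k w by (auto simp: Z_def B_def)
  have Zsq: "integrable M (\<lambda>w. (Z k w)\<^sup>2)" for k
    by (rule Bochner_Integration.integrable_bound[OF sq[of k]]) (use Zle in \<open>auto simp: Z_def\<close>)
  have Zmg: "AE w in M. real_cond_exp M (F k) (Z k) w = 0" for k
  proof -
    interpret C: finite_measure_subalgebra M "F k" by unfold_locales (rule sub)
    have "integrable M (Z k)"
    proof (rule Bochner_Integration.integrable_bound)
      show "integrable M (\<lambda>w. 1 + (Z k w)\<^sup>2)" using Zsq by simp
      have "\<bar>z\<bar> \<le> 1 + z\<^sup>2" for z :: real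
        using sum_squares_bound[of 1 "\<bar>z\<bar>"] by simp
      then show "AE w in M. norm (Z k w) \<le> norm (1 + (Z k w)\<^sup>2)" by simp
    qed (simp add: Z_def)
    then have "AE w in M. real_cond_exp M (F k) (Z k) w = B k w * real_cond_exp M (F k) (Y k) w"
      unfolding Z_def by (intro C.real_cond_exp_mult) auto
    then show ?thesis using mg[of k] by eventually_elim simp
  qed
  define T where "T = (\<lambda>w. \<Sum>k<N. Z k w)"
  have T2: "integrable M (\<lambda>w. (T w)\<^sup>2)"
    and ET: "expectation (\<lambda>w. (T w)\<^sup>2) = (\<Sum>k<N. expectation (\<lambda>w. (Z k w)\<^sup>2))"
    unfolding T_def using orthogonal_sum_square(2,3)[where F=F and Y=Z, OF sub filt ZF Zsq Zmg] by auto
  \<comment> \<open>After the first exit index \<open>n\<close> all terms of \<open>Z\<close>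
    vanish, so the stopped sum is frozen at \<open>S n w\<close>, which lies outside the
    interval.\<close>
  have stop: "\<epsilon> \<le> \<bar>T w\<bar>" if ex: "\<exists>n\<le>N. \<epsilon> \<le> \<bar>S n w\<bar>" for w
  proof -
    define n where "n = (LEAST n. \<epsilon> \<le> \<bar>S n w\<bar>)"
    have n: "\<epsilon> \<le> \<bar>S n w\<bar>" "n \<le> N"
      and less: "\<And>j. j < n \<Longrightarrow> \<bar>S j w\<bar> < \<epsilon>"
      using ex unfolding n_def by (auto intro: LeastI order_trans[OF Least_le] dest: not_less_Least)
    have "T w = (\<Sum>k<n. Z k w) + (\<Sum>k\<in>{n..<N}. Z k w)"
      unfolding T_def using n(2) by (simp add: sum.atLeastLessThan_concat lessThan_atLeast0)
    also have "(\<Sum>k<n. Z k w) = S n w"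
      unfolding S_def by (rule sum.cong) (auto simp: Z_def B_def intro: less)
    also have "(\<Sum>k\<in>{n..<N}. Z k w) = 0"
      using n(1) by (intro sum.neutral) (auto simp: Z_def B_def dest!: bspec[of _ _ n])
    finally show ?thesis using n(1) by simp
  qed
  have stop': "\<epsilon>\<^sup>2 \<le> (T w)\<^sup>2" if "\<exists>n\<le>N. \<epsilon> \<le> \<bar>S n w\<bar>" for w
    using power_mono[OF stop[OF that], of 2] eps by simp
  have [measurable]: "T \<in> borel_measurable M" unfolding T_def Z_def by simp
  have "prob {w\<in>space M. \<exists>n\<le>N. \<epsilon> \<le> \<bar>\<Sum>k<n. Y k w\<bar>} \<le> prob {w\<in>space M. \<epsilon>\<^sup>2 \<le> (T w)\<^sup>2}"
  proof (rule finite_measure_mono)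
    show "{w\<in>space M. \<exists>n\<le>N. \<epsilon> \<le> \<bar>\<Sum>k<n. Y k w\<bar>} \<subseteq> {w\<in>space M. \<epsilon>\<^sup>2 \<le> (T w)\<^sup>2}"
      using stop' unfolding S_def by blast
  qed simp
  also have "\<dots> \<le> expectation (\<lambda>w. (T w)\<^sup>2) / \<epsilon>\<^sup>2"
    using integral_Markov_inequality_measure[OF T2, of "space M" "\<epsilon>\<^sup>2"] eps by simp
  also have "\<dots> \<le> (\<Sum>k<N. expectation (\<lambda>w. (Y k w)\<^sup>2)) / \<epsilon>\<^sup>2"
    unfolding ET using eps
    by (intro divide_right_mono sum_mono integral_mono Zsq sq Zle) auto
  finally show ?thesis .
qed

lemma (in prob_space) kolmogorov_maximal:
  fixes Y :: "nat \<Rightarrow> 'a \<Rightarrow> real"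
  assumes sub: "\<And>k. subalgebra M (F k)" and filt: "\<And>k. subalgebra (F (Suc k)) (F k)"
    and Y[measurable]: "\<And>k. Y k \<in> borel_measurable (F (Suc k))"
    and sq: "\<And>k. integrable M (\<lambda>w. (Y k w)\<^sup>2)"
    and mg: "\<And>k. AE w in M. real_cond_exp M (F k) (Y k) w = 0"
    and summ: "summable (\<lambda>k. expectation (\<lambda>w. (Y k w)\<^sup>2))"
    and eps: "0 < \<epsilon>"
  shows "prob {w\<in>space M. \<exists>n. \<epsilon> \<le> \<bar>\<Sum>k<n. Y k w\<bar>} \<le> (\<Sum>k. expectation (\<lambda>w. (Y k w)\<^sup>2)) / \<epsilon>\<^sup>2"
proof -
  have YM[measurable]: "Y n \<in> borel_measurable M" for n
    by (rule measurable_from_subalg[OF sub Y])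
  define E where "E = (\<lambda>N. {w\<in>space M. \<exists>n\<le>N. \<epsilon> \<le> \<bar>\<Sum>k<n. Y k w\<bar>})"
  have lim: "(\<lambda>N. prob (E N)) \<longlonglongrightarrow> prob (\<Union>N. E N)"
    by (rule finite_Lim_measure_incseq) (auto simp: E_def incseq_def intro: order_trans)
  have le: "prob (E N) \<le> (\<Sum>k. expectation (\<lambda>w. (Y k w)\<^sup>2)) / \<epsilon>\<^sup>2" for N
  proof -
    have "prob (E N) \<le> (\<Sum>k<N. expectation (\<lambda>w. (Y k w)\<^sup>2)) / \<epsilon>\<^sup>2"
      unfolding E_def by (rule kolmogorov_maximal_finite[where F=F and Y=Y, OF sub filt Y sq mg eps])
    also have "\<dots> \<le> (\<Sum>k. expectation (\<lambda>w. (Y k w)\<^sup>2)) / \<epsilon>\<^sup>2"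
      by (intro divide_right_mono sum_le_suminf summ) auto
    finally show ?thesis .
  qed
  have "prob (\<Union>N. E N) \<le> (\<Sum>k. expectation (\<lambda>w. (Y k w)\<^sup>2)) / \<epsilon>\<^sup>2"
    by (rule LIMSEQ_le_const2[OF lim]) (use le in auto)
  moreover have "(\<Union>N. E N) = {w\<in>space M. \<exists>n. \<epsilon> \<le> \<bar>\<Sum>k<n. Y k w\<bar>}"
    by (auto simp: E_def)
  ultimately show ?thesis by simp
qed

text \<open>The maximal inequality is applied to the martingale restarted at \<open>m\<close>. Its
  total variance is a tail of a convergent series, so the event that every restart leaves the
  \<epsilon>-interval is null. Taking \<epsilon> from the countable family
  \<open>1 / (j + 1)\<close> makes almost every path Cauchy.\<close>

lemma (in prob_space) L2_martingale_convergence: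
  fixes Y :: "nat \<Rightarrow> 'a \<Rightarrow> real"
  assumes sub: "\<And>k. subalgebra M (F k)" and filt: "\<And>k. subalgebra (F (Suc k)) (F k)"
    and Y[measurable]: "\<And>k. Y k \<in> borel_measurable (F (Suc k))"
    and sq: "\<And>k. integrable M (\<lambda>w. (Y k w)\<^sup>2)"
    and mg: "\<And>k. AE w in M. real_cond_exp M (F k) (Y k) w = 0"
    and summ: "summable (\<lambda>k. expectation (\<lambda>w. (Y k w)\<^sup>2))"
  shows "AE w in M. convergent (\<lambda>n. \<Sum>k<n. Y k w)"
proof -
  have YM[measurable]: "Y n \<in> borel_measurable M" for n
    by (rule measurable_from_subalg[OF sub Y])
  have small: "AE w in M. \<exists>m. \<forall>n. \<bar>\<Sum>k<n. Y (k + m) w\<bar> < \<epsilon>" if eps: "0 < \<epsilon>" for \<epsilon>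
  proof -
    define E where "E = (\<lambda>m. {w\<in>space M. \<exists>n. \<epsilon> \<le> \<bar>\<Sum>k<n. Y (k + m) w\<bar>})"
    have [measurable]: "E m \<in> sets M" for m unfolding E_def by measurable
    have le: "prob (\<Inter>m. E m) \<le> (\<Sum>k. expectation (\<lambda>w. (Y (k + m) w)\<^sup>2)) / \<epsilon>\<^sup>2" for m
    proof -
      have "prob (\<Inter>m. E m) \<le> prob (E m)" by (rule finite_measure_mono) auto
      also have "\<dots> \<le> (\<Sum>k. expectation (\<lambda>w. (Y (k + m) w)\<^sup>2)) / \<epsilon>\<^sup>2"
        unfolding E_def
      proof (rule kolmogorov_maximal[where F="\<lambda>k. F (k + m)"])
        show "summable (\<lambda>k. expectation (\<lambda>w. (Y (k + m) w)\<^sup>2))"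
          using summ by (subst summable_iff_shift)
      qed (use sub filt sq mg eps Y[of "_ + m"] in auto)
      finally show ?thesis .
    qed
    have "(\<lambda>m. (\<Sum>k. expectation (\<lambda>w. (Y (k + m) w)\<^sup>2)) / \<epsilon>\<^sup>2) \<longlonglongrightarrow> 0 / \<epsilon>\<^sup>2"
      by (intro tendsto_divide tendsto_const suminf_exist_split2[OF summ]) (use eps in auto)
    then have "prob (\<Inter>m. E m) \<le> 0 / \<epsilon>\<^sup>2"
      by (rule LIMSEQ_le_const) (use le in auto)
    then have "prob (\<Inter>m. E m) = 0" by (simp add: measure_le_0_iff)
    then have "AE w in M. w \<notin> (\<Inter>m. E m)"
      by (intro AE_not_in) (simp add: null_sets_def emeasure_eq_measure)
    moreover have "AE w in M. w \<in> space M" by (rule AE_space)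
    ultimately show ?thesis
      by eventually_elim (auto simp: E_def not_le)
  qed
  have "AE w in M. \<forall>j::nat. \<exists>m. \<forall>n. \<bar>\<Sum>k<n. Y (k + m) w\<bar> < inverse (real (Suc j))"
    by (subst AE_all_countable) (intro allI small, simp)
  then show ?thesis
  proof eventually_elim
    case (elim w)
    define S where "S = (\<lambda>n. \<Sum>k<n. Y k w)"
    have tail: "(\<Sum>k<n. Y (k + m) w) = S (n + m) - S m" for n m
      by (induction n) (auto simp: S_def)
    have "Cauchy S"
    proof (rule metric_CauchyI)
      fix e :: real assume "0 < e"
      then obtain j where j: "inverse (real (Suc j)) < e / 2"
        using reals_Archimedean[of "e/2"] by auto
      obtain m where m: "\<And>n. \<bar>S (n + m) - S m\<bar> < inverse (real (Suc j))"
        using elim tail by metis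
      have "dist (S a) (S b) < e" if "a \<ge> m" "b \<ge> m" for a b
        using m[of "a - m"] m[of "b - m"] that j by (simp add: dist_real_def)
      then show "\<exists>M. \<forall>m\<ge>M. \<forall>n\<ge>M. dist (S m) (S n) < e" by blast
    qed
    then show ?case unfolding S_def using Cauchy_convergent_iff by blast
  qed
qed

section \<open>Almost supermartingales\<close>

text \<open>The terms \<open>t\<close> have no sign, but their partial sums \<open>T\<close>
  converge and hence are bounded, so \<open>V - T\<close> decreases and is bounded below.\<close>

lemma descent_convergent:
  fixes V t W :: "nat \<Rightarrow> real"
  assumes V: "\<And>k. 0 \<le> V k" and W: "\<And>k. 0 \<le> W k"
    and step: "\<And>k. V (Suc k) \<le> V k + t k - W k"
    and t: "convergent (\<lambda>n. \<Sum>k<n. t k)"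
  shows "convergent V" and "summable W"
proof -
  define T where "T = (\<lambda>n. \<Sum>k<n. t k)"
  have T: "convergent T" using t by (simp add: T_def)
  then obtain B where B: "\<And>n. \<bar>T n\<bar> \<le> B"
    using convergent_imp_Bseq[OF T] unfolding Bseq_def by auto
  have "decseq (\<lambda>n. V n - T n)"
    by (rule decseq_SucI) (use step W in \<open>simp add: T_def, smt (verit)\<close>)
  moreover have "\<forall>n. - B \<le> V n - T n"
    using V B by (smt (verit))
  ultimately obtain L where "(\<lambda>n. V n - T n) \<longlonglongrightarrow> L"
    by (rule decseq_convergent)
  then have "convergent (\<lambda>n. V n - T n)" by (rule convergentI)
  from convergent_add[OF this T] show "convergent V" by simp
  have part: "(\<Sum>k<n. W k) \<le> V 0 - V n + T n" for n
  proof (induction n)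
    case (Suc n)
    then show ?case using step[of n] by (simp add: T_def)
  qed (simp add: T_def)
  have "(\<Sum>k<Suc n. W k) \<le> V 0 + B" for n
    using part[of "Suc n"] V[of "Suc n"] abs_le_D1[OF B[of "Suc n"]] by linarith
  then have "(\<Sum>k\<le>n. W k) \<le> V 0 + B" for n
    by (simp only: lessThan_Suc_atMost)
  with W show "summable W" by (rule bounded_imp_summable)
qed

text \<open>Summing the recursion telescopes to \<open>(1 - r) * (\<Sum>k<n. u k) \<le> u 0 - u n +
  (\<Sum>k<n. b k)\<close>.\<close>

lemma contraction_summable:
  fixes u b :: "nat \<Rightarrow> real"
  assumes u: "\<And>k. 0 \<le> u k" and b: "\<And>k. 0 \<le> b k" "summable b" and r: "r < 1"
    and step: "\<And>k. u (Suc k) \<le> r * u k + b k"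
  shows "summable u"
proof -
  have "(1 - r) * (\<Sum>k<n. u k) \<le> u 0 - u n + (\<Sum>k<n. b k)" for n
  proof (induction n)
    case (Suc n)
    then show ?case using step[of n] by (simp add: algebra_simps)
  qed simp
  moreover have "(\<Sum>k<n. b k) \<le> suminf b" for n
    by (rule sum_le_suminf) (use b in auto)
  ultimately have le: "(1 - r) * (\<Sum>k<n. u k) \<le> u 0 + suminf b" for n
    using u[of n] by (metis add_mono diff_add_cancel order_trans le_add_same_cancel1)
  have bound: "(\<Sum>k<n. u k) \<le> (u 0 + suminf b) / (1 - r)" for n
    using le[of n] r by (simp add: field_simps)
  have "(\<Sum>k\<le>n. u k) \<le> (u 0 + suminf b) / (1 - r)" for n
    using bound[of "Suc n"] by (simp only: lessThan_Suc_atMost)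
  with u show ?thesis by (rule bounded_imp_summable)
qed

text \<open>A discrete Gronwall inequality: the product of the factors \<open>1 + a k\<close> is
  dominated by the exponential of the sum of the \<open>a k\<close>.\<close>

lemma perturbed_recursion_bounded:
  fixes u a c :: "nat \<Rightarrow> real"
  assumes u: "0 \<le> u 0" and a: "\<And>k. 0 \<le> a k" "summable a" and c: "\<And>k. 0 \<le> c k" "summable c"
    and step: "\<And>k. u (Suc k) \<le> (1 + a k) * u k + c k"
  shows "\<exists>L\<ge>0. \<forall>k. u k \<le> L"
proof -
  have "u n \<le> exp (\<Sum>k<n. a k) * (u 0 + (\<Sum>k<n. c k))" for n
  proof (induction n)
    case (Suc n)
    let ?E = "exp (\<Sum>k<n. a k)" and ?C = "u 0 + (\<Sum>k<n. c k)"
    have C: "0 \<le> ?C" using u c by (simp add: sum_nonneg)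
    have E: "1 \<le> exp (\<Sum>k<Suc n. a k)" using a(1) by (simp only: one_le_exp_iff) (rule sum_nonneg, simp)
    have "u (Suc n) \<le> (1 + a n) * (?E * ?C) + c n"
      using step[of n] mult_left_mono[OF Suc, of "1 + a n"] a(1)[of n] by linarith
    also have "(1 + a n) * (?E * ?C) \<le> exp (a n) * (?E * ?C)"
      by (rule mult_right_mono) (use C in auto)
    also have "exp (a n) * (?E * ?C) = exp (\<Sum>k<Suc n. a k) * ?C" by (simp add: exp_add)
    also have "c n \<le> exp (\<Sum>k<Suc n. a k) * c n" using E c(1)[of n] by (simp add: mult_le_cancel_right1)
    finally show ?case by (simp add: algebra_simps)
  qed simp
  moreover have "exp (\<Sum>k<n. a k) * (u 0 + (\<Sum>k<n. c k)) \<le> exp (suminf a) * (u 0 + suminf c)" for n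
    by (intro mult_mono add_mono iffD2[OF exp_le_cancel_iff] sum_le_suminf order_refl a c add_nonneg_nonneg u sum_nonneg)
      (use a c in auto)
  moreover have "0 \<le> exp (suminf a) * (u 0 + suminf c)"
    using u suminf_nonneg[OF c(2)] c(1) by simp
  ultimately show ?thesis by (intro exI[of _ "exp (suminf a) * (u 0 + suminf c)"]) (blast intro: order_trans)
qed

text \<open>By monotone convergence the random series has finite expectation, hence is almost surely
  finite.\<close>

lemma (in prob_space) AE_summable_of_summable_expectation:
  fixes X :: "nat \<Rightarrow> 'a \<Rightarrow> real"
  assumes int: "\<And>k. integrable M (X k)" and nonneg: "\<And>k w. w \<in> space M \<Longrightarrow> 0 \<le> X k w"
    and summ: "summable (\<lambda>k. expectation (X k))"
  shows "AE w in M. summable (\<lambda>k. X k w)"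
proof -
  have [measurable]: "X k \<in> borel_measurable M" for k using int by auto
  have "(\<integral>\<^sup>+w. (\<Sum>k. ennreal (X k w)) \<partial>M) = (\<Sum>k. \<integral>\<^sup>+w. ennreal (X k w) \<partial>M)"
    by (rule nn_integral_suminf) simp
  also have "\<dots> = (\<Sum>k. ennreal (expectation (X k)))"
    by (intro suminf_cong nn_integral_eq_integral int AE_I2 nonneg)
  also have "\<dots> = ennreal (\<Sum>k. expectation (X k))"
    by (intro suminf_ennreal2 integral_nonneg_AE AE_I2 nonneg summ)
  finally have "(\<integral>\<^sup>+w. (\<Sum>k. ennreal (X k w)) \<partial>M) \<noteq> \<infinity>" by simp
  then have "AE w in M. (\<Sum>k. ennreal (X k w)) \<noteq> \<infinity>"
    by (intro nn_integral_PInf_AE) auto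
  moreover have "AE w in M. w \<in> space M" by (rule AE_space)
  ultimately show ?thesis
    by eventually_elim (rule summable_suminf_not_top, auto intro: nonneg)
qed

text \<open>A Robbins-Siegmund theorem with the noise term \<open>s\<close> kept explicit. Since
  \<open>s\<close> is controlled by \<open>V\<close> and not by a constant, the expectation of
  \<open>V\<close> is bounded first; this makes both the variances of \<open>s\<close> and the
  growth terms \<open>a k * V k\<close> summable in mean.\<close>

lemma (in prob_space) almost_supermartingale_convergence:
  fixes V s W :: "nat \<Rightarrow> 'a \<Rightarrow> real"
  assumes sub: "\<And>k. subalgebra M (F k)" and filt: "\<And>k. subalgebra (F (Suc k)) (F k)"
    and V: "\<And>k. integrable M (V k)" "\<And>k w. w \<in> space M \<Longrightarrow> 0 \<le> V k w"
    and W: "\<And>k w. w \<in> space M \<Longrightarrow> 0 \<le> W k w"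
    and s: "\<And>k. s k \<in> borel_measurable (F (Suc k))"
    and mg: "\<And>k. AE w in M. real_cond_exp M (F k) (s k) w = 0"
    and var: "\<And>k. AE w in M. (s k w)\<^sup>2 \<le> b k * V k w"
    and a: "\<And>k. 0 \<le> a k" "summable a" and b: "\<And>k. 0 \<le> b k" "summable b"
    and c: "\<And>k. 0 \<le> c k" "summable c"
    and step: "\<And>k. AE w in M. V (Suc k) w \<le> (1 + a k) * V k w + c k - W k w + s k w"
  shows "AE w in M. convergent (\<lambda>k. V k w) \<and> summable (\<lambda>k. W k w)"
proof -
  have sM[measurable]: "s k \<in> borel_measurable M" for k by (rule measurable_from_subalg[OF sub s])
  have s2: "integrable M (\<lambda>w. (s k w)\<^sup>2)" for k
  proof (rule Bochner_Integration.integrable_bound)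
    show "integrable M (\<lambda>w. b k * V k w)" using V by simp
    show "AE w in M. norm ((s k w)\<^sup>2) \<le> norm (b k * V k w)"
      using var[of k] by eventually_elim (simp add: order_trans[OF _ abs_ge_self])
  qed simp
  have s1: "integrable M (s k)" for k
    using square_integrable_imp_integrable[OF sM s2] .
  have s0: "expectation (s k) = 0" for k
  proof -
    interpret S: finite_measure_subalgebra M "F k" by unfold_locales (rule sub)
    have "expectation (s k) = expectation (real_cond_exp M (F k) (s k))"
      using S.real_cond_exp_int(2)[OF s1] by simp
    also have "\<dots> = expectation (\<lambda>w. 0)"
      by (rule integral_cong_AE) (use mg[of k] in auto)
    finally show ?thesis by simp
  qed
  have EV: "expectation (V (Suc k)) \<le> (1 + a k) * expectation (V k) + c k" for k
  proof -
    have "expectation (V (Suc k)) \<le> expectation (\<lambda>w. (1 + a k) * V k w + c k + s k w)"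
    proof (rule integral_mono_AE)
      have "AE w in M. w \<in> space M" by (rule AE_space)
      then show "AE w in M. V (Suc k) w \<le> (1 + a k) * V k w + c k + s k w"
        using step[of k] by eventually_elim (smt (verit) W)
    qed (use V s1 in auto)
    also have "\<dots> = (1 + a k) * expectation (V k) + c k"
      using V s1 s0 by (simp add: prob_space)
    finally show ?thesis .
  qed
  have EV0: "0 \<le> expectation (V k)" for k by (intro integral_nonneg_AE AE_I2 V)
  obtain L where L: "0 \<le> L" "\<And>k. expectation (V k) \<le> L"
    using perturbed_recursion_bounded[where u="\<lambda>k. expectation (V k)", OF EV0 a c EV] by auto
  have Es: "expectation (\<lambda>w. (s k w)\<^sup>2) \<le> b k * L" for k
  proof -
    have "expectation (\<lambda>w. (s k w)\<^sup>2) \<le> expectation (\<lambda>w. b k * V k w)"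
      by (rule integral_mono_AE) (use s2 V var in auto)
    also have "\<dots> \<le> b k * L" using L(2)[of k] b(1)[of k] by (simp add: mult_left_mono)
    finally show ?thesis .
  qed
  have "summable (\<lambda>k. expectation (\<lambda>w. (s k w)\<^sup>2))"
    by (rule summable_comparison_test'[OF summable_mult2[OF b(2), of L]]) (use Es in auto)
  then have conv_s: "AE w in M. convergent (\<lambda>n. \<Sum>k<n. s k w)"
    by (intro L2_martingale_convergence[where F=F] sub filt s s2 mg)
  have "summable (\<lambda>k. expectation (\<lambda>w. a k * V k w))"
    by (rule summable_comparison_test'[OF summable_mult2[OF a(2), of L]])
      (use a L EV0 in \<open>auto simp: abs_mult intro: mult_left_mono\<close>)
  \<comment> \<open>With this the multiplicative growth becomes one more summable driving term, and
    each path satisfies a plain descent inequality.\<close>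
  then have summ_a: "AE w in M. summable (\<lambda>k. a k * V k w)"
    by (intro AE_summable_of_summable_expectation) (use V a in auto)
  have "AE w in M. \<forall>k. V (Suc k) w \<le> (1 + a k) * V k w + c k - W k w + s k w"
    by (subst AE_all_countable) (intro allI step)
  moreover have "AE w in M. w \<in> space M" by (rule AE_space)
  ultimately show ?thesis using conv_s summ_a
  proof eventually_elim
    case (elim w)
    have "convergent (\<lambda>n. (\<Sum>k<n. a k * V k w + c k) + (\<Sum>k<n. s k w))"
      by (intro convergent_add elim summable_iff_convergent[THEN iffD1] summable_add c)
    then have "convergent (\<lambda>n. \<Sum>k<n. (a k * V k w + c k + s k w))"
      by (simp add: sum.distrib)
    with elim V W show ?case
      by (intro conjI descent_convergent[of "\<lambda>k. V k w" "\<lambda>k. W k w" "\<lambda>k. a k * V k w + c k + s k w"])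
        (auto simp: algebra_simps)
  qed
qed

section \<open>Conditional bias of clipping\<close>

lemma norm_clip_le: "0 \<le> \<tau> \<Longrightarrow> norm (clip \<tau> g) \<le> \<tau>"
  by (cases "g = 0") (auto simp: clip_def min_def field_simps)

text \<open>If clipping acts, the error is the excess of the norm over \<tau>, at most
  \<open>norm \<xi>\<close>. Writing this as
  \<open>norm \<xi> powr (1 - \<delta>) * norm \<xi> powr \<delta>\<close> exploits that the first
  exponent is negative and that \<open>norm \<xi>\<close> is at least
  \<open>\<tau> / 2\<close>.\<close>

lemma clip_bias:
  fixes q \<xi> :: "'b::real_normed_vector"
  assumes q: "2 * norm q \<le> \<tau>" and \<tau>: "0 < \<tau>" and \<delta>: "1 < \<delta>"
  shows "norm (clip \<tau> (q + \<xi>) - (q + \<xi>)) \<le> (\<tau> / 2) powr (1 - \<delta>) * norm \<xi> powr \<delta>"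
proof (cases "norm (q + \<xi>) \<le> \<tau>")
  case True
  then have "clip \<tau> (q + \<xi>) = q + \<xi>"
    by (cases "q + \<xi> = 0") (auto simp: clip_def min_def field_simps)
  then show ?thesis by simp
next
  case False
  have tri: "norm (q + \<xi>) \<le> norm q + norm \<xi>" by (rule norm_triangle_ineq)
  have x: "\<tau> / 2 \<le> norm \<xi>" "0 < norm \<xi>" using False q \<tau> tri by auto
  have "\<tau> / norm (q + \<xi>) \<le> 1" using False \<tau> by (simp add: divide_le_eq_1)
  then have "clip \<tau> (q + \<xi>) - (q + \<xi>) = (\<tau> / norm (q + \<xi>) - 1) *\<^sub>R (q + \<xi>)"
    by (simp add: clip_def min_absorb2 scaleR_left_diff_distrib)
  then have "norm (clip \<tau> (q + \<xi>) - (q + \<xi>)) = \<bar>(\<tau> / norm (q + \<xi>) - 1) * norm (q + \<xi>)\<bar>"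
    by (simp add: abs_mult)
  also have "(\<tau> / norm (q + \<xi>) - 1) * norm (q + \<xi>) = \<tau> - norm (q + \<xi>)"
  proof -
    have "norm (q + \<xi>) \<noteq> 0" using False \<tau> by linarith
    then show ?thesis by (simp add: left_diff_distrib)
  qed
  also have "\<bar>\<tau> - norm (q + \<xi>)\<bar> \<le> norm \<xi>" using False tri q \<tau> by linarith
  also have "norm \<xi> = norm \<xi> powr (1 - \<delta>) * norm \<xi> powr \<delta>"
    using x by (simp add: powr_add[symmetric])
  also have "\<dots> \<le> (\<tau> / 2) powr (1 - \<delta>) * norm \<xi> powr \<delta>"
    by (intro mult_right_mono powr_mono2') (use x \<tau> \<delta> in auto)
  finally show ?thesis .
qed

text \<open>In the application \<open>q\<close> is the gradient and \<open>u\<close> the vector from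
  the minimizer to the current point. Both are known given \<open>F\<close>, so only the noise is
  averaged. A lower bound is what is wanted, because this inner product enters the squared distance
  with a minus sign.\<close>

lemma (in prob_space) clip_cond_exp_lower:
  fixes q u \<xi> :: "'a \<Rightarrow> real ^ 'n"
  assumes sub: "subalgebra M F"
    and q: "q \<in> borel_measurable F" "\<And>w. w \<in> space M \<Longrightarrow> 2 * norm (q w) \<le> \<tau>"
    and u: "u \<in> borel_measurable F" "\<And>w. w \<in> space M \<Longrightarrow> norm (u w) \<le> K"
    and \<xi>[measurable]: "\<xi> \<in> borel_measurable M"
    and \<tau>: "0 < \<tau>" and \<delta>: "1 < \<delta>"
    and moment: "AE w in M. nn_cond_exp M F (\<lambda>w. ennreal (norm (\<xi> w) powr \<delta>)) w \<le> ennreal (\<nu> powr \<delta>)"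
    and centred: "AE w in M. vec_cond_exp M F \<xi> w = 0"
  shows "AE w in M. q w \<bullet> u w - (\<nu> powr \<delta> * (\<tau> / 2) powr (1 - \<delta>)) * norm (u w)
           \<le> real_cond_exp M F (\<lambda>w. clip \<tau> (q w + \<xi> w) \<bullet> u w) w"
proof -
  interpret S: finite_measure_subalgebra M F by unfold_locales (rule sub)
  note qM[measurable] = measurable_from_subalg[OF sub q(1)]
  note uM[measurable] = measurable_from_subalg[OF sub u(1)]
  define p where "p = (\<lambda>w. norm (\<xi> w) powr \<delta>)"
  define \<gamma> where "\<gamma> = (\<tau> / 2) powr (1 - \<delta>)"
  have \<gamma>: "0 \<le> \<gamma>" by (simp add: \<gamma>_def)
  have pM[measurable]: "p \<in> borel_measurable M" unfolding p_def by measurable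
  \<comment> \<open>Unconditional integrability is not a hypothesis; it follows by integrating the
    bound on the conditional moment.\<close>
  have p_int: "integrable M p"
  proof (rule integrableI_bounded)
    have "(\<integral>\<^sup>+ w. ennreal (norm (p w)) \<partial>M) = (\<integral>\<^sup>+ w. 1 * ennreal (p w) \<partial>M)" by (simp add: p_def)
    also have "\<dots> = (\<integral>\<^sup>+ w. 1 * nn_cond_exp M F (\<lambda>w. ennreal (p w)) w \<partial>M)"
      by (rule S.nn_cond_exp_intg[symmetric]) auto
    also have "\<dots> \<le> (\<integral>\<^sup>+ w. ennreal (\<nu> powr \<delta>) \<partial>M)"
      by (rule nn_integral_mono_AE) (use moment in \<open>auto simp: p_def\<close>)
    also have "\<dots> < \<infinity>" by (simp add: emeasure_space_1)
    finally show "(\<integral>\<^sup>+ w. ennreal (norm (p w)) \<partial>M) < \<infinity>" .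
  qed simp
  have \<xi>_int: "integrable M (\<lambda>w. norm (\<xi> w))"
  proof (rule Bochner_Integration.integrable_bound)
    show "integrable M (\<lambda>w. 1 + p w)" using p_int by simp
    have "t \<le> 1 + t powr \<delta>" if "0 \<le> t" for t :: real
    proof (cases "t \<le> 1")
      case False
      then have "t powr 1 \<le> t powr \<delta>" using \<delta> by (intro powr_mono) auto
      then show ?thesis using False by simp
    qed (simp add: add_increasing2)
    then show "AE w in M. norm (norm (\<xi> w)) \<le> norm (1 + p w)" by (simp add: p_def)
  qed simp
  have int_times_u: "integrable M (\<lambda>w. h w * z w)"
    if h: "integrable M h" and z: "z \<in> borel_measurable M" "\<And>w. w \<in> space M \<Longrightarrow> \<bar>z w\<bar> \<le> norm (u w)"
    for h z :: "'a \<Rightarrow> real"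
  proof (rule Bochner_Integration.integrable_bound)
    show "integrable M (\<lambda>w. h w * K)" using h by simp
    show "(\<lambda>w. h w * z w) \<in> borel_measurable M" using h z by auto
    have "\<bar>z w\<bar> \<le> \<bar>K\<bar>" if "w \<in> space M" for w using z(2)[OF that] u(2)[OF that] by linarith
    then show "AE w in M. norm (h w * z w) \<le> norm (h w * K)"
      by (intro AE_I2) (simp add: abs_mult mult_left_mono)
  qed
  have \<xi>_c[measurable]: "(\<lambda>w. \<xi> w $ i) \<in> borel_measurable M" for i
    by (intro borel_measurable_continuous_on[OF _ \<xi>] continuous_intros)
  have \<xi>c_int: "integrable M (\<lambda>w. \<xi> w $ i)" for i
    by (rule Bochner_Integration.integrable_bound[OF \<xi>_int]) (auto intro: component_le_norm_cart)
  have bounded_int: "integrable M h" if "h \<in> borel_measurable M" "\<And>w. w \<in> space M \<Longrightarrow> \<bar>h w\<bar> \<le> B"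
    for h :: "'a \<Rightarrow> real" and B
    by (rule integrable_const_bound[of _ B]) (use that in auto)
  define h1 where "h1 = (\<lambda>w. q w \<bullet> u w)"
  \<comment> \<open>This is the inner product of \<open>\<xi>\<close> and \<open>u\<close>, split
    into coordinates because \<open>vec_cond_exp\<close> is defined coordinatewise.\<close>
  define h2 where "h2 = (\<lambda>w. \<Sum>i\<in>UNIV. u w $ i * \<xi> w $ i)"
  define h3 where "h3 = (\<lambda>w. (\<gamma> * norm (u w)) * p w)"
  have u_c[measurable]: "(\<lambda>w. u w $ i) \<in> borel_measurable F" for i
    using u(1) by (intro borel_measurable_continuous_on[OF _ u(1)] continuous_intros)
  have u_cM[measurable]: "(\<lambda>w. u w $ i) \<in> borel_measurable M" for i
    by (rule measurable_from_subalg[OF sub u_c])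
  have int1: "integrable M h1"
  proof (rule bounded_int)
    show "h1 \<in> borel_measurable M" unfolding h1_def by measurable
    fix w assume w: "w \<in> space M"
    have "\<bar>q w \<bullet> u w\<bar> \<le> norm (q w) * norm (u w)" by (rule Cauchy_Schwarz_ineq2)
    also have "\<dots> \<le> \<tau> * K" using q(2)[OF w] u(2)[OF w] \<tau> by (intro mult_mono) auto
    finally show "\<bar>h1 w\<bar> \<le> \<tau> * K" by (simp add: h1_def)
  qed
  have int2i: "integrable M (\<lambda>w. u w $ i * \<xi> w $ i)" for i
    using int_times_u[OF \<xi>c_int u_cM, of i i] by (simp add: component_le_norm_cart mult.commute)
  have int2: "integrable M h2" unfolding h2_def using int2i by simp
  have int3: "integrable M h3"
    using integrable_mult_right[OF int_times_u[OF p_int, of "\<lambda>w. norm (u w)"], of \<gamma>]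
    by (simp add: h3_def algebra_simps)
  have int0: "integrable M (\<lambda>w. clip \<tau> (q w + \<xi> w) \<bullet> u w)"
  proof (rule bounded_int)
    show "(\<lambda>w. clip \<tau> (q w + \<xi> w) \<bullet> u w) \<in> borel_measurable M" unfolding clip_def by measurable
    fix w assume w: "w \<in> space M"
    have "\<bar>clip \<tau> (q w + \<xi> w) \<bullet> u w\<bar> \<le> norm (clip \<tau> (q w + \<xi> w)) * norm (u w)" by (rule Cauchy_Schwarz_ineq2)
    also have "\<dots> \<le> \<tau> * K" using u(2)[OF w] \<tau> norm_clip_le[of \<tau>] by (intro mult_mono) auto
    finally show "\<bar>clip \<tau> (q w + \<xi> w) \<bullet> u w\<bar> \<le> \<tau> * K" .
  qed
  have pointwise: "h1 w + h2 w - h3 w \<le> clip \<tau> (q w + \<xi> w) \<bullet> u w" if w: "w \<in> space M" for w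
  proof -
    let ?R = "clip \<tau> (q w + \<xi> w) - (q w + \<xi> w)"
    have "- (?R \<bullet> u w) \<le> norm ?R * norm (u w)"
      using Cauchy_Schwarz_ineq2[of ?R "u w"] by linarith
    also have "\<dots> \<le> (\<gamma> * p w) * norm (u w)"
      unfolding \<gamma>_def p_def by (intro mult_right_mono clip_bias q(2) w \<tau> \<delta>) simp
    also have "\<dots> = h3 w" by (simp add: h3_def)
    moreover have "h2 w = \<xi> w \<bullet> u w" by (simp add: h2_def inner_vec_def mult.commute)
    ultimately show ?thesis by (simp add: h1_def inner_diff_left inner_add_left)
  qed
  have mono: "AE w in M. real_cond_exp M F (\<lambda>w. (h1 w + h2 w) - h3 w) w
      \<le> real_cond_exp M F (\<lambda>w. clip \<tau> (q w + \<xi> w) \<bullet> u w) w"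
    by (rule S.real_cond_exp_mono) (use pointwise int0 int1 int2 int3 in auto)
  have split3: "AE w in M. real_cond_exp M F (\<lambda>w. (h1 w + h2 w) - h3 w) w =
      real_cond_exp M F (\<lambda>w. h1 w + h2 w) w - real_cond_exp M F h3 w"
    by (rule S.real_cond_exp_diff) (use int1 int2 int3 in auto)
  have split12: "AE w in M. real_cond_exp M F (\<lambda>w. h1 w + h2 w) w =
      real_cond_exp M F h1 w + real_cond_exp M F h2 w"
    by (rule S.real_cond_exp_add) (use int1 int2 in auto)
  have ce1: "AE w in M. real_cond_exp M F h1 w = h1 w"
  proof (rule S.real_cond_exp_F_meas[OF int1])
    show "h1 \<in> borel_measurable F" unfolding h1_def using q(1) u(1) by (rule borel_measurable_inner)
  qed
  have ce2i: "AE w in M. real_cond_exp M F (\<lambda>w. u w $ i * \<xi> w $ i) w = u w $ i * real_cond_exp M F (\<lambda>w. \<xi> w $ i) w" for i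
    by (rule S.real_cond_exp_mult) (use int2i in auto)
  have "AE w in M. \<forall>i. real_cond_exp M F (\<lambda>w. u w $ i * \<xi> w $ i) w = u w $ i * real_cond_exp M F (\<lambda>w. \<xi> w $ i) w"
    using ce2i by (subst AE_all_countable) auto
  moreover have "AE w in M. real_cond_exp M F h2 w = (\<Sum>i\<in>UNIV. real_cond_exp M F (\<lambda>w. u w $ i * \<xi> w $ i) w)"
    unfolding h2_def by (rule S.real_cond_exp_sum) (rule int2i)
  ultimately have ce2: "AE w in M. real_cond_exp M F h2 w = 0"
    using centred by eventually_elim (simp add: vec_cond_exp_def vec_eq_iff)
  have ce3: "AE w in M. real_cond_exp M F h3 w = (\<gamma> * norm (u w)) * real_cond_exp M F p w"
    unfolding h3_def
    by (rule S.real_cond_exp_mult) (use int3 u(1) in \<open>auto simp: h3_def\<close>)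
  \<comment> \<open>The moment bound concerns \<open>nn_cond_exp\<close>; the real conditional
    expectation is the difference of two such terms, and dropping the subtracted one only increases
    it.\<close>
  have "AE w in M. real_cond_exp M F p w \<le> \<nu> powr \<delta>"
    using moment
  proof eventually_elim
    case (elim w)
    then have "enn2real (nn_cond_exp M F (\<lambda>w. ennreal (p w)) w) \<le> \<nu> powr \<delta>"
      unfolding p_def by (rule enn2real_leI[rotated]) simp
    then show ?case unfolding real_cond_exp_def
      using enn2real_nonneg[of "nn_cond_exp M F (\<lambda>w. ennreal (- p w)) w"] by linarith
  qed
  with mono split3 split12 ce1 ce2 ce3 show ?thesis
  proof eventually_elim
    case (elim w)
    have "(\<gamma> * norm (u w)) * real_cond_exp M F p w \<le> (\<gamma> * norm (u w)) * \<nu> powr \<delta>"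
      using elim \<gamma> by (intro mult_left_mono) auto
    with elim show ?case by (simp add: h1_def \<gamma>_def mult_ac)
  qed
qed

section \<open>Consensus under doubly stochastic averaging\<close>

lemma doubly_stochasticD:
  assumes "doubly_stochastic A"
  shows "0 \<le> A $ i $ j" and "(\<Sum>i\<in>UNIV. A $ i $ j) = 1" and "(\<Sum>j\<in>UNIV. A $ i $ j) = 1"
  using assms by (auto simp: doubly_stochastic_def)

text \<open>Each row is a probability distribution, so its weighted squared deviation from the row
  mean is second moment minus squared mean. Summed over the rows, the second moments collapse
  because the columns also sum to 1.\<close>

lemma doubly_stochastic_variance:
  fixes A :: "real ^ 'a ^ 'a" and y :: "'a::finite \<Rightarrow> 'b::real_inner"
  assumes A: "doubly_stochastic A"
  shows "(\<Sum>i\<in>UNIV. \<Sum>j\<in>UNIV. A $ i $ j * (norm (y j - (\<Sum>l\<in>UNIV. A $ i $ l *\<^sub>R y l)))\<^sup>2)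
    = (\<Sum>j\<in>UNIV. (norm (y j))\<^sup>2) - (\<Sum>i\<in>UNIV. (norm (\<Sum>l\<in>UNIV. A $ i $ l *\<^sub>R y l))\<^sup>2)"
proof -
  define m where "m = (\<lambda>i. \<Sum>l\<in>UNIV. A $ i $ l *\<^sub>R y l)"
  have "(\<Sum>j\<in>UNIV. A $ i $ j * (norm (y j - m i))\<^sup>2)
      = (\<Sum>j\<in>UNIV. A $ i $ j * (norm (y j))\<^sup>2) - (norm (m i))\<^sup>2" for i
  proof -
    have "(\<Sum>j\<in>UNIV. A $ i $ j * (norm (y j - m i))\<^sup>2)
      = (\<Sum>j\<in>UNIV. A $ i $ j * (norm (y j))\<^sup>2 - 2 * ((A $ i $ j *\<^sub>R y j) \<bullet> m i) + A $ i $ j * (norm (m i))\<^sup>2)"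
      by (rule sum.cong) (auto simp: power2_norm_eq_inner inner_commute algebra_simps)
    also have "\<dots> = (\<Sum>j\<in>UNIV. A $ i $ j * (norm (y j))\<^sup>2) - 2 * (m i \<bullet> m i)
        + (\<Sum>j\<in>UNIV. A $ i $ j) * (norm (m i))\<^sup>2"
      unfolding sum.distrib sum_subtractf sum_distrib_left[symmetric] sum_distrib_right[symmetric]
        inner_sum_left[symmetric] by (simp add: m_def)
    finally show ?thesis using doubly_stochasticD(3)[OF A, of i] by (simp add: power2_norm_eq_inner)
  qed
  then have "(\<Sum>i\<in>UNIV. \<Sum>j\<in>UNIV. A $ i $ j * (norm (y j - m i))\<^sup>2)
      = (\<Sum>i\<in>UNIV. \<Sum>j\<in>UNIV. A $ i $ j * (norm (y j))\<^sup>2) - (\<Sum>i\<in>UNIV. (norm (m i))\<^sup>2)"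
    by (simp add: sum_subtractf)
  also have "(\<Sum>i\<in>UNIV. \<Sum>j\<in>UNIV. A $ i $ j * (norm (y j))\<^sup>2) = (\<Sum>j\<in>UNIV. \<Sum>i\<in>UNIV. A $ i $ j * (norm (y j))\<^sup>2)"
    by (rule sum.swap)
  also have "\<dots> = (\<Sum>j\<in>UNIV. (norm (y j))\<^sup>2)"
    by (simp add: sum_distrib_right[symmetric] doubly_stochasticD(2)[OF A])
  finally show ?thesis by (simp add: m_def)
qed

lemma doubly_stochastic_norm_le:
  fixes A :: "real ^ 'a ^ 'a" and y :: "'a::finite \<Rightarrow> 'b::real_inner"
  assumes A: "doubly_stochastic A"
  shows "(\<Sum>i\<in>UNIV. (norm (\<Sum>l\<in>UNIV. A $ i $ l *\<^sub>R y l))\<^sup>2) \<le> (\<Sum>j\<in>UNIV. (norm (y j))\<^sup>2)"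
proof -
  have "0 \<le> (\<Sum>i\<in>UNIV. \<Sum>j\<in>UNIV. A $ i $ j * (norm (y j - (\<Sum>l\<in>UNIV. A $ i $ l *\<^sub>R y l)))\<^sup>2)"
    by (intro sum_nonneg mult_nonneg_nonneg doubly_stochasticD(1)[OF A]) auto
  then show ?thesis using doubly_stochastic_variance[OF A, of y] by linarith
qed

text \<open>Without loss of norm every row variance is 0, so agent \<open>i\<close> sees only values
  equal to its row mean. The self-loop makes that mean its own value, and equality spreads along
  directed paths.\<close>

lemma doubly_stochastic_norm_eq_imp_consensus:
  fixes A :: "real ^ 'a ^ 'a" and y :: "'a::finite \<Rightarrow> 'b::real_inner"
  assumes A: "doubly_stochastic A" and loops: "\<And>i. i \<in> in_neighbours A i"
    and conn: "strongly_connected A"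
    and eq: "(\<Sum>j\<in>UNIV. (norm (y j))\<^sup>2) \<le> (\<Sum>i\<in>UNIV. (norm (\<Sum>l\<in>UNIV. A $ i $ l *\<^sub>R y l))\<^sup>2)"
  shows "y i = y j"
proof -
  define m where "m = (\<lambda>i. \<Sum>l\<in>UNIV. A $ i $ l *\<^sub>R y l)"
  have nonneg: "0 \<le> A $ i $ j * (norm (y j - m i))\<^sup>2" for i j
    by (intro mult_nonneg_nonneg doubly_stochasticD(1)[OF A]) auto
  have "(\<Sum>i\<in>UNIV. \<Sum>j\<in>UNIV. A $ i $ j * (norm (y j - m i))\<^sup>2) \<le> 0"
    using doubly_stochastic_variance[OF A, of y] eq by (simp add: m_def)
  moreover have "0 \<le> (\<Sum>i\<in>UNIV. \<Sum>j\<in>UNIV. A $ i $ j * (norm (y j - m i))\<^sup>2)"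
    by (intro sum_nonneg nonneg)
  ultimately have "(\<Sum>i\<in>UNIV. \<Sum>j\<in>UNIV. A $ i $ j * (norm (y j - m i))\<^sup>2) = 0" by linarith
  then have zero: "A $ i $ j * (norm (y j - m i))\<^sup>2 = 0" for i j
    using nonneg by (simp add: sum_nonneg_eq_0_iff sum_nonneg)
  have nb: "y j = m i" if "j \<in> in_neighbours A i" for i j
    using zero[of i j] that by (auto simp: in_neighbours_def)
  have edge: "y j = y i" if "(j, i) \<in> edges A" for i j
    using nb[of j i] nb[OF loops[of i]] that by (simp add: edges_def)
  have "(i, j) \<in> (edges A)\<^sup>*" using conn by (simp add: strongly_connected_def)
  then show ?thesis by (induction rule: rtrancl_induct) (auto dest: edge)
qed

text \<open>A single averaging step already contracts: on the compact unit sphere of the zero-sum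
  subspace the norm after averaging attains its maximum, and a maximum of 1 would force consensus,
  hence the zero vector. Homogeneity extends the bound to all zero-sum vectors.\<close>

lemma doubly_stochastic_contraction_real:
  fixes A :: "real ^ 'a ^ 'a::finite"
  assumes A: "doubly_stochastic A" and loops: "\<And>i. i \<in> in_neighbours A i"
    and conn: "strongly_connected A"
  shows "\<exists>r\<ge>0. r < 1 \<and> (\<forall>y :: 'a \<Rightarrow> real. (\<Sum>j\<in>UNIV. y j) = 0 \<longrightarrow>
    (\<Sum>i\<in>UNIV. (\<Sum>j\<in>UNIV. A $ i $ j * y j)\<^sup>2) \<le> r * (\<Sum>j\<in>UNIV. (y j)\<^sup>2))"
proof -
  define Q where "Q = (\<lambda>y :: 'a \<Rightarrow> real. \<Sum>i\<in>UNIV. (\<Sum>j\<in>UNIV. A $ i $ j * y j)\<^sup>2)"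
  define S where "S = sphere 0 1 \<inter> {y :: real ^ 'a. (\<Sum>j\<in>UNIV. y $ j) = 0}"
  have Q0: "0 \<le> Q y" for y by (simp add: Q_def sum_nonneg)
  have scale: "Q (\<lambda>j. c * y j) = c\<^sup>2 * Q y" for c y
    unfolding Q_def sum_distrib_left power_mult_distrib[symmetric]
    by (intro sum.cong refl) (simp add: sum_distrib_left mult_ac)
  have nrm: "(norm y)\<^sup>2 = (\<Sum>j\<in>UNIV. (y $ j)\<^sup>2)" for y :: "real ^ 'a"
    by (simp add: norm_vec_def L2_set_def sum_nonneg)
  obtain r where r: "0 \<le> r" "r < 1" "\<And>y. y \<in> S \<Longrightarrow> Q (($) y) \<le> r"
  proof (cases "S = {}")
    \<comment> \<open>The case of a single agent, where zero sum already forces the vector to be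
      0.\<close>
    case True
    then show ?thesis using that[of 0] by auto
  next
    case False
    have "compact S"
      unfolding S_def by (intro compact_Int_closed compact_sphere closed_Collect_eq continuous_intros)
    moreover have "continuous_on S (\<lambda>y. Q (($) y))"
      unfolding Q_def by (intro continuous_intros)
    ultimately obtain z where z: "z \<in> S" "\<And>y. y \<in> S \<Longrightarrow> Q (($) y) \<le> Q (($) z)"
      using continuous_attains_sup[OF _ False] by blast
    have "Q (($) z) < 1"
    proof (rule ccontr)
      assume "\<not> Q (($) z) < 1"
      then have "(\<Sum>j\<in>UNIV. (norm (z $ j))\<^sup>2) \<le> (\<Sum>i\<in>UNIV. (norm (\<Sum>l\<in>UNIV. A $ i $ l *\<^sub>R z $ l))\<^sup>2)"
        using z(1) nrm[of z] by (simp add: S_def Q_def)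
      then have const: "z $ i = z $ j" for i j
        by (rule doubly_stochastic_norm_eq_imp_consensus[OF A loops conn])
      have "z $ i = 0" for i
      proof -
        have "(\<Sum>j\<in>UNIV. z $ j) = (\<Sum>j\<in>(UNIV::'a set). z $ i)"
          by (rule sum.cong) (auto intro: const)
        then show ?thesis using z(1) by (simp add: S_def)
      qed
      then have "z = 0" by (simp add: vec_eq_iff)
      then show False using z(1) by (simp add: S_def)
    qed
    then show ?thesis using that Q0 z(2) by blast
  qed
  have "Q y \<le> r * (\<Sum>j\<in>UNIV. (y j)\<^sup>2)" if y: "(\<Sum>j\<in>UNIV. y j) = 0" for y
  proof -
    define n where "n = norm (vec_lambda y)"
    have n2: "n\<^sup>2 = (\<Sum>j\<in>UNIV. (y j)\<^sup>2)" by (simp add: n_def nrm)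
    show ?thesis
    proof (cases "n = 0")
      case True
      then have "vec_lambda y = 0" by (simp add: n_def)
      then have "y j = 0" for j by (metis vec_lambda_beta zero_index)
      then show ?thesis by (simp add: Q_def)
    next
      case False
      have "(1 / n) *\<^sub>R vec_lambda y \<in> S"
        using False y by (simp add: S_def n_def sum_distrib_left[symmetric] sum_divide_distrib[symmetric])
      from r(3)[OF this] have "Q (\<lambda>j. (1 / n) * y j) \<le> r"
        unfolding vector_scaleR_component vec_lambda_beta real_scaleR_def .
      then have "Q y / n\<^sup>2 \<le> r" unfolding scale by (simp add: power_divide)
      then show ?thesis using False by (simp add: n2[symmetric] field_simps)
    qed
  qed
  then show ?thesis using r(1,2) unfolding Q_def by blast
qed

text \<open>Averaging acts on each coordinate separately, so the scalar factor \<open>r\<close>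
  serves every coordinate at once.\<close>

lemma doubly_stochastic_contraction:
  fixes A :: "real ^ 'a ^ 'a::finite"
  assumes A: "doubly_stochastic A" and loops: "\<And>i. i \<in> in_neighbours A i"
    and conn: "strongly_connected A"
  shows "\<exists>r\<ge>0. r < 1 \<and> (\<forall>y :: 'a \<Rightarrow> 'b::euclidean_space. (\<Sum>j\<in>UNIV. y j) = 0 \<longrightarrow>
    (\<Sum>i\<in>UNIV. (norm (\<Sum>j\<in>UNIV. A $ i $ j *\<^sub>R y j))\<^sup>2) \<le> r * (\<Sum>j\<in>UNIV. (norm (y j))\<^sup>2))"
proof -
  obtain r where r: "0 \<le> r" "r < 1" and contr: "\<And>y :: 'a \<Rightarrow> real. (\<Sum>j\<in>UNIV. y j) = 0 \<Longrightarrow>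
    (\<Sum>i\<in>UNIV. (\<Sum>j\<in>UNIV. A $ i $ j * y j)\<^sup>2) \<le> r * (\<Sum>j\<in>UNIV. (y j)\<^sup>2)"
    using doubly_stochastic_contraction_real[OF A loops conn] by blast
  have nrm: "(norm z)\<^sup>2 = (\<Sum>b\<in>Basis. (z \<bullet> b)\<^sup>2)" for z :: 'b
    unfolding power2_norm_eq_inner by (subst euclidean_inner) (simp add: power2_eq_square)
  have "(\<Sum>i\<in>UNIV. (norm (\<Sum>j\<in>UNIV. A $ i $ j *\<^sub>R y j))\<^sup>2) \<le> r * (\<Sum>j\<in>UNIV. (norm (y j))\<^sup>2)"
    if y: "(\<Sum>j\<in>UNIV. y j) = 0" for y :: "'a \<Rightarrow> 'b"
  proof -
    have "(\<Sum>i\<in>UNIV. (norm (\<Sum>j\<in>UNIV. A $ i $ j *\<^sub>R y j))\<^sup>2)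
        = (\<Sum>b\<in>Basis. \<Sum>i\<in>UNIV. (\<Sum>j\<in>UNIV. A $ i $ j * (y j \<bullet> b))\<^sup>2)"
      unfolding nrm by (subst sum.swap) (simp add: inner_sum_left)
    also have "\<dots> \<le> (\<Sum>b\<in>Basis. r * (\<Sum>j\<in>UNIV. (y j \<bullet> b)\<^sup>2))"
    proof (intro sum_mono contr)
      show "(\<Sum>j\<in>UNIV. y j \<bullet> b) = 0" for b
        using y by (simp add: inner_sum_left[symmetric])
    qed
    also have "\<dots> = r * (\<Sum>j\<in>UNIV. (norm (y j))\<^sup>2)"
      unfolding nrm sum_distrib_left[symmetric] by (subst sum.swap) simp
    finally show ?thesis .
  qed
  then show ?thesis using r by blast
qed

section \<open>Disagreement under averaging with perturbations\<close>

definition mean :: "('a::finite \<Rightarrow> 'b::real_vector) \<Rightarrow> 'b" where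
  "mean y = (1 / real CARD('a)) *\<^sub>R (\<Sum>i\<in>UNIV. y i)"

text \<open>The Euclidean norm of the stacked deviations: the contraction of squared norms then acts
  by the factor \<open>sqrt r\<close>, and Minkowski's inequality separates the
  perturbation.\<close>

definition disagreement :: "('a::finite \<Rightarrow> 'b::real_normed_vector) \<Rightarrow> real" where
  "disagreement y = L2_set (\<lambda>i. norm (y i - mean y)) UNIV"

lemma norm_diff_mean_le: "norm (y i - mean y) \<le> disagreement y"
  unfolding disagreement_def by (rule member_le_L2_set) auto

lemma disagreement_nonneg: "0 \<le> disagreement y"
  unfolding disagreement_def by (rule L2_set_nonneg)

lemma sum_diff_mean:
  fixes y :: "'a::finite \<Rightarrow> 'b::real_vector"
  shows "(\<Sum>i\<in>UNIV. y i - mean y) = 0"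
  by (simp add: sum_subtractf mean_def sum_constant_scaleR)

lemma doubly_stochastic_sum:
  fixes A :: "real ^ 'a ^ 'a" and y :: "'a::finite \<Rightarrow> 'b::real_vector"
  assumes A: "doubly_stochastic A"
  shows "(\<Sum>i\<in>UNIV. \<Sum>j\<in>UNIV. A $ i $ j *\<^sub>R y j) = (\<Sum>j\<in>UNIV. y j)"
  by (subst sum.swap) (simp add: scaleR_sum_left[symmetric] doubly_stochasticD(2)[OF A])

lemma doubly_stochastic_diff:
  fixes A :: "real ^ 'a ^ 'a" and y :: "'a::finite \<Rightarrow> 'b::real_vector"
  assumes A: "doubly_stochastic A"
  shows "(\<Sum>j\<in>UNIV. A $ i $ j *\<^sub>R (y j - c)) = (\<Sum>j\<in>UNIV. A $ i $ j *\<^sub>R y j) - c"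
  by (simp add: scaleR_diff_right sum_subtractf scaleR_sum_left[symmetric] doubly_stochasticD(3)[OF A])

text \<open>Unit column sums preserve the mean, so averaging acts on the deviations alone, and these
  sum to 0. The perturbation contributes \<open>e i - mean e\<close>, of norm at most
  \<open>2 * \<epsilon>\<close> for each agent; bounding the Euclidean norm by the sum gives the
  factor \<open>CARD('a)\<close>.\<close>

lemma disagreement_step:
  fixes A :: "real ^ 'a ^ 'a" and y e :: "'a::finite \<Rightarrow> 'b::euclidean_space"
  assumes A: "doubly_stochastic A"
    and contr: "\<And>y :: 'a \<Rightarrow> 'b. (\<Sum>j\<in>UNIV. y j) = 0 \<Longrightarrow>
      (\<Sum>i\<in>UNIV. (norm (\<Sum>j\<in>UNIV. A $ i $ j *\<^sub>R y j))\<^sup>2) \<le> r * (\<Sum>j\<in>UNIV. (norm (y j))\<^sup>2)"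
    and e: "\<And>i. norm (e i) \<le> \<epsilon>"
  shows "disagreement (\<lambda>i. (\<Sum>j\<in>UNIV. A $ i $ j *\<^sub>R y j) + e i)
    \<le> sqrt r * disagreement y + 2 * real CARD('a) * \<epsilon>"
proof -
  define m where "m = mean y"
  define z where "z = (\<lambda>j. y j - m)"
  have sum_z: "(\<Sum>j\<in>UNIV. z j) = 0" unfolding z_def m_def by (rule sum_diff_mean)
  have mean': "mean (\<lambda>i. (\<Sum>j\<in>UNIV. A $ i $ j *\<^sub>R y j) + e i) = m + mean e"
    by (simp add: mean_def m_def sum.distrib doubly_stochastic_sum[OF A] scaleR_add_right)
  have norm_mean: "norm (mean e) \<le> \<epsilon>"
  proof -
    have "norm (\<Sum>i\<in>UNIV. e i) \<le> real CARD('a) * \<epsilon>"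
      using sum_norm_bound[of UNIV e \<epsilon>] e by simp
    then show ?thesis by (simp add: mean_def field_simps)
  qed
  have Az: "(\<Sum>j\<in>UNIV. A $ i $ j *\<^sub>R y j) - m = (\<Sum>j\<in>UNIV. A $ i $ j *\<^sub>R z j)" for i
    unfolding z_def by (simp add: doubly_stochastic_diff[OF A])
  have "disagreement (\<lambda>i. (\<Sum>j\<in>UNIV. A $ i $ j *\<^sub>R y j) + e i)
      = L2_set (\<lambda>i. norm ((\<Sum>j\<in>UNIV. A $ i $ j *\<^sub>R z j) + (e i - mean e))) UNIV"
    unfolding disagreement_def mean' Az[symmetric] by (simp add: algebra_simps)
  also have "\<dots> \<le> L2_set (\<lambda>i. norm (\<Sum>j\<in>UNIV. A $ i $ j *\<^sub>R z j) + norm (e i - mean e)) UNIV"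
    by (rule L2_set_mono) (auto intro: norm_triangle_ineq)
  also have "\<dots> \<le> L2_set (\<lambda>i. norm (\<Sum>j\<in>UNIV. A $ i $ j *\<^sub>R z j)) UNIV + L2_set (\<lambda>i. norm (e i - mean e)) UNIV"
    by (rule L2_set_triangle_ineq)
  also have "L2_set (\<lambda>i. norm (\<Sum>j\<in>UNIV. A $ i $ j *\<^sub>R z j)) UNIV \<le> sqrt r * disagreement y"
    unfolding disagreement_def L2_set_def real_sqrt_mult[symmetric] m_def[symmetric]
    using contr[OF sum_z] by (simp add: z_def)
  also have "L2_set (\<lambda>i. norm (e i - mean e)) UNIV \<le> (\<Sum>i\<in>UNIV. norm (e i - mean e))"
    by (rule L2_set_le_sum) auto
  also have "\<dots> \<le> (\<Sum>i\<in>(UNIV :: 'a set). 2 * \<epsilon>)"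
  proof (rule sum_mono)
    fix i show "norm (e i - mean e) \<le> 2 * \<epsilon>"
      using norm_triangle_ineq4[of "e i" "mean e"] e[of i] norm_mean by linarith
  qed
  finally show ?thesis by simp
qed

section \<open>Step sizes and gradients\<close>

lemma eventually_constant_sign:
  fixes h :: "nat \<Rightarrow> real"
  assumes "monoseq h"
  shows "(\<exists>K. \<forall>k\<ge>K. h k \<le> 0) \<or> (\<exists>K. \<forall>k\<ge>K. 0 \<le> h k)"
proof -
  consider "incseq h" | "decseq h" using assms by (auto simp: monoseq_iff)
  then show ?thesis
  proof cases
    case 1
    show ?thesis
    proof (cases "\<exists>K. 0 \<le> h K")
      case True
      then show ?thesis using 1 by (meson incseqD order_trans)
    qed (auto simp: not_le intro: less_imp_le)
  next
    case 2
    show ?thesis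
    proof (cases "\<exists>K. h K \<le> 0")
      case True
      then obtain K where "h K \<le> 0" ..
      then have "\<forall>k\<ge>K. h k \<le> 0" using decseqD[OF 2] order_trans by blast
      then show ?thesis by blast
    next
      case False
      then have "\<forall>k\<ge>0. 0 \<le> h k" by (auto simp: not_le intro: less_imp_le)
      then show ?thesis by blast
    qed
  qed
qed

text \<open>
  Up to the factor \<open>\<alpha> k\<close>, the terms are monotone in \<open>k\<close>, so their sign is eventually constant; this is
  what allows the series to diverge to \<open>-\<infinity>\<close>.
\<close>

lemma summable_positive_part:
  assumes \<alpha>: "\<And>k. 0 < \<alpha> k" "decseq \<alpha>" and \<omega>: "0 < \<omega>"
    and series: "series_less_infinity (\<lambda>k. \<omega> * \<alpha> k powr \<omega>' - \<mu> * \<alpha> k)"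
  shows "summable (\<lambda>k. max 0 (\<omega> * \<alpha> k powr \<omega>' - \<mu> * \<alpha> k))"
proof -
  define h where "h = (\<lambda>k. \<omega> * \<alpha> k powr (\<omega>' - 1) - \<mu>)"
  define t where "t = (\<lambda>k. \<omega> * \<alpha> k powr \<omega>' - \<mu> * \<alpha> k)"
  have t: "t k = \<alpha> k * h k" for k
  proof -
    have "\<alpha> k * \<alpha> k powr (\<omega>' - 1) = \<alpha> k powr \<omega>'"
      using \<alpha>(1)[of k] powr_add[of "\<alpha> k" 1 "\<omega>' - 1"] by simp
    then show ?thesis by (simp add: t_def h_def algebra_simps)
  qed
  \<comment> \<open>As \<open>\<alpha>\<close> decreases,
    \<open>\<alpha> k powr (\<omega>' - 1)\<close> decreases or increases according to the sign of
    the exponent.\<close>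
  have "monoseq h"
  proof (cases "1 \<le> \<omega>'")
    case True
    then have "decseq h" unfolding h_def decseq_def using \<alpha> \<omega>
      by (auto intro!: powr_mono2 dest: decseqD less_imp_le)
    then show ?thesis by (simp add: monoseq_iff)
  next
    case False
    then have "incseq h" unfolding h_def incseq_def using \<alpha> \<omega>
      by (auto intro!: powr_mono2' dest: decseqD less_imp_le)
    then show ?thesis by (simp add: monoseq_iff)
  qed
  from eventually_constant_sign[OF this]
  consider K where "\<And>k. k \<ge> K \<Longrightarrow> t k \<le> 0" | K where "\<And>k. k \<ge> K \<Longrightarrow> 0 \<le> t k"
    unfolding t using \<alpha>(1) by (meson less_imp_le mult_nonneg_nonneg mult_nonneg_nonpos)
  then have "summable (\<lambda>k. max 0 (t k))"
  proof cases
    case 1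
    then show ?thesis by (intro summable_finite[of "{..<K}"]) (auto simp: max_def not_less intro: antisym)
  next
    case 2
    obtain S :: ereal where S: "S < \<infinity>" "(\<lambda>n. ereal (\<Sum>k<n. t k)) \<longlonglongrightarrow> S"
      using series by (auto simp: series_less_infinity_def t_def)
    \<comment> \<open>The hypothesis bounds the partial sums from above only; this suffices where
      the terms are nonnegative.\<close>
    obtain B :: nat where "S < ereal (real B)"
      using S(1) less_PInf_Ex_of_nat[of S] by auto
    then have "eventually (\<lambda>n. ereal (\<Sum>k<n. t k) < ereal (real B)) sequentially"
      using order_tendstoD(2)[OF S(2)] by blast
    then obtain n0 where n0: "\<And>n. n \<ge> n0 \<Longrightarrow> (\<Sum>k<n. t k) < real B"
      by (auto simp: eventually_sequentially)
    have split: "(\<Sum>k<n + K. t k) = (\<Sum>k<n. t (k + K)) + (\<Sum>k<K. t k)" for n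
      by (induction n) auto
    have "(\<Sum>k\<le>n. t (k + K)) \<le> real B - (\<Sum>k<K. t k)" for n
    proof -
      have "(\<Sum>k\<le>n. t (k + K)) \<le> (\<Sum>k<n + n0 + 1. t (k + K))"
        by (rule sum_mono2) (use 2 in auto)
      then show ?thesis using n0[of "n + n0 + 1 + K"] split[of "n + n0 + 1"] by linarith
    qed
    with 2 have "summable (\<lambda>k. t (k + K))"
      by (intro bounded_imp_summable[where B="real B - (\<Sum>k<K. t k)"]) auto
    moreover have "t (k + K) = max 0 (t (k + K))" for k using 2[of "k + K"] by simp
    ultimately have "summable (\<lambda>k. max 0 (t (k + K)))" by simp
    then show ?thesis by (subst (asm) summable_iff_shift)
  qed
  then show ?thesis by (simp add: t_def)
qed

text \<open>Convexity is available on \<open>S\<close> only, so the derivative along the segment is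
  taken as a right limit of difference quotients, each at most \<open>h y - h x\<close> by the chord
  inequality.\<close>

lemma convex_on_gradient_inequality:
  fixes h :: "'b::euclidean_space \<Rightarrow> real"
  assumes conv: "convex_on S h" and xy: "x \<in> S" "y \<in> S" and diff: "h differentiable (at x)"
  shows "gradient h x \<bullet> (y - x) \<le> h y - h x"
proof -
  define \<phi> where "\<phi> = (\<lambda>t. h (x + t *\<^sub>R (y - x)))"
  have "(h has_derivative (\<lambda>z. z \<bullet> gradient h x)) (at (x + 0 *\<^sub>R (y - x)))"
    using GDERIV_gradient[OF diff] by (simp add: gderiv_def)
  moreover have "((\<lambda>t::real. x + t *\<^sub>R (y - x)) has_derivative (\<lambda>t. t *\<^sub>R (y - x))) (at 0)"
    by (auto intro!: derivative_eq_intros)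
  ultimately have "(\<phi> has_derivative (\<lambda>t. (t *\<^sub>R (y - x)) \<bullet> gradient h x)) (at 0)"
    unfolding \<phi>_def by (rule has_derivative_compose[rotated])
  moreover have "(\<lambda>t. (t *\<^sub>R (y - x)) \<bullet> gradient h x) = (*) ((y - x) \<bullet> gradient h x)"
    by (simp add: fun_eq_iff)
  ultimately have "(\<phi> has_field_derivative (y - x) \<bullet> gradient h x) (at 0)"
    by (simp add: has_field_derivative_def)
  then have "((\<lambda>t. (\<phi> t - \<phi> 0) / t) \<longlongrightarrow> (y - x) \<bullet> gradient h x) (at_right 0)"
    by (simp add: has_field_derivative_iff filterlim_at_split)
  moreover have "\<forall>\<^sub>F t in at_right (0::real). (\<phi> t - \<phi> 0) / t \<le> h y - h x"
  proof (rule eventually_at_rightI[of 0 1])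
    fix t :: real assume t: "t \<in> {0<..<1}"
    have "h ((1 - t) *\<^sub>R x + t *\<^sub>R y) \<le> (1 - t) * h x + t * h y"
      using convex_onD[OF conv, of t x y] t xy by simp
    moreover have "(1 - t) *\<^sub>R x + t *\<^sub>R y = x + t *\<^sub>R (y - x)" by (simp add: algebra_simps)
    ultimately have "\<phi> t - \<phi> 0 \<le> t * (h y - h x)" by (simp add: \<phi>_def algebra_simps)
    then show "(\<phi> t - \<phi> 0) / t \<le> h y - h x" using t by (simp add: field_simps)
  qed simp
  ultimately have "(y - x) \<bullet> gradient h x \<le> h y - h x"
    by (rule tendsto_upperbound) simp
  then show ?thesis by (simp add: inner_commute)
qed

lemma summable_mult_of_squares:
  fixes a b :: "nat \<Rightarrow> real"
  assumes "summable (\<lambda>k. (a k)\<^sup>2)" and "summable (\<lambda>k. (b k)\<^sup>2)"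
  shows "summable (\<lambda>k. a k * b k)"
proof (rule summable_comparison_test')
  show "summable (\<lambda>k. (a k)\<^sup>2 + (b k)\<^sup>2)" using assms by (rule summable_add)
  fix k
  have "2 * \<bar>a k\<bar> * \<bar>b k\<bar> \<le> (a k)\<^sup>2 + (b k)\<^sup>2"
    using sum_squares_bound[of "\<bar>a k\<bar>" "\<bar>b k\<bar>"] by simp
  moreover have "0 \<le> \<bar>a k\<bar> * \<bar>b k\<bar>" by simp
  ultimately show "norm (a k * b k) \<le> (a k)\<^sup>2 + (b k)\<^sup>2"
    unfolding real_norm_def abs_mult by linarith
qed

text \<open>Both claims reduce to \<open>contraction_summable\<close>. Since \<open>\<alpha>\<close>
  decreases, \<open>\<alpha> k * D k\<close> inherits the recursion with input
  \<open>\<alpha> k * b k\<close>, a product of two square-summable sequences; and the squares of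
  \<open>D\<close> satisfy a recursion of their own.\<close>

lemma geometric_recursion:
  fixes D b \<alpha> :: "nat \<Rightarrow> real"
  assumes D: "\<And>k. 0 \<le> D k" and step: "\<And>k. D (Suc k) \<le> \<rho> * D k + b k"
    and \<rho>: "0 \<le> \<rho>" "\<rho> < 1" and b: "\<And>k. 0 \<le> b k" "summable (\<lambda>k. (b k)\<^sup>2)"
    and \<alpha>: "\<And>k. 0 \<le> \<alpha> k" "decseq \<alpha>" "summable (\<lambda>k. (\<alpha> k)\<^sup>2)"
  shows "summable (\<lambda>k. \<alpha> k * D k)" and "D \<longlonglongrightarrow> 0"
proof -
  show "summable (\<lambda>k. \<alpha> k * D k)"
  proof (rule contraction_summable[where r=\<rho> and b="\<lambda>k. \<alpha> k * b k"])
    fix k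
    have "\<alpha> (Suc k) * D (Suc k) \<le> \<alpha> k * D (Suc k)"
      using \<alpha>(2) D by (intro mult_right_mono) (auto simp: decseq_Suc_iff)
    also have "\<dots> \<le> \<alpha> k * (\<rho> * D k + b k)" using step \<alpha>(1) by (rule mult_left_mono)
    finally show "\<alpha> (Suc k) * D (Suc k) \<le> \<rho> * (\<alpha> k * D k) + \<alpha> k * b k"
      by (simp add: algebra_simps)
  qed (use D \<alpha> b \<rho> in \<open>auto intro: summable_mult_of_squares\<close>)
  have "summable (\<lambda>k. (D k)\<^sup>2)"
  proof (rule contraction_summable[where r=\<rho> and b="\<lambda>k. (b k)\<^sup>2 / (1 - \<rho>)"])
    fix k
    have "(D (Suc k))\<^sup>2 \<le> (\<rho> * D k + b k)\<^sup>2" using step D by (rule power_mono)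
    \<comment> \<open>Convexity of the square with weights \<rho> and \<open>1 - \<rho>\<close>,
      applied to \<open>D k\<close> and \<open>b k / (1 - \<rho>)\<close>; the subtracted square is
      the exact gap. The contraction factor remains \<rho>.\<close>
    also have "\<dots> = \<rho> * (D k)\<^sup>2 + (b k)\<^sup>2 / (1 - \<rho>) - \<rho> / (1 - \<rho>) * ((1 - \<rho>) * D k - b k)\<^sup>2"
      using \<rho>(2) by (simp add: power2_eq_square divide_simps) (simp add: algebra_simps)
    also have "\<dots> \<le> \<rho> * (D k)\<^sup>2 + (b k)\<^sup>2 / (1 - \<rho>)" using \<rho> by simp
    finally show "(D (Suc k))\<^sup>2 \<le> \<rho> * (D k)\<^sup>2 + (b k)\<^sup>2 / (1 - \<rho>)" .
  qed (use b \<rho> in \<open>auto intro: summable_divide\<close>)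
  then have "(\<lambda>k. sqrt ((D k)\<^sup>2)) \<longlonglongrightarrow> sqrt 0"
    by (intro tendsto_real_sqrt summable_LIMSEQ_zero)
  then show "D \<longlonglongrightarrow> 0" using D by simp
qed

lemma frequently_small_of_weighted_summable:
  fixes \<alpha> h :: "nat \<Rightarrow> real"
  assumes \<alpha>: "\<And>k. 0 \<le> \<alpha> k" "\<not> summable \<alpha>" and summ: "summable (\<lambda>k. \<alpha> k * h k)" and \<epsilon>: "0 < \<epsilon>"
  shows "\<exists>k\<ge>n. h k < \<epsilon>"
proof (rule ccontr)
  assume "\<not> ?thesis"
  then have h: "\<And>k. k \<ge> n \<Longrightarrow> \<epsilon> \<le> h k" by (auto simp: not_less)
  have "summable \<alpha>"
  proof (rule summable_comparison_test'[of "\<lambda>k. (\<alpha> k * h k) / \<epsilon>" n])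
    show "norm (\<alpha> k) \<le> (\<alpha> k * h k) / \<epsilon>" if "k \<ge> n" for k
      using mult_left_mono[OF h[OF that] \<alpha>(1)[of k]] \<alpha>(1)[of k] \<epsilon> by (simp add: field_simps)
  qed (use summ in \<open>simp add: summable_divide\<close>)
  with \<alpha>(2) show False ..
qed

section \<open>Convergence of Fejer monotone sequences\<close>

text \<open>A subsequence of \<open>y\<close> along which the gap vanishes has a minimizer
  \<open>z\<close> as cluster point. Convergence of the distances is known only for points of
  \<open>Q\<close>, which need not contain \<open>z\<close>, so \<open>z\<close> is approximated
  from \<open>Q\<close> and the limit of the distances to the approximation is read off along the
  subsequence.\<close>

lemma fejer_monotone_convergence:
  fixes x :: "'i::finite \<Rightarrow> nat \<Rightarrow> 'b::euclidean_space" and y :: "nat \<Rightarrow> 'b" and h :: "'b \<Rightarrow> real"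
  assumes \<Omega>: "closed \<Omega>" "continuous_on \<Omega> h" "\<And>k. y k \<in> \<Omega>"
    and Q: "Q \<subseteq> minimizers \<Omega> h" "minimizers \<Omega> h \<subseteq> closure Q" "minimizers \<Omega> h \<noteq> {}"
    and conv: "\<And>\<theta>. \<theta> \<in> Q \<Longrightarrow> convergent (\<lambda>k. \<Sum>i\<in>UNIV. (norm (x i k - \<theta>))\<^sup>2)"
    and summ: "\<And>\<theta>. \<theta> \<in> Q \<Longrightarrow> summable (\<lambda>k. \<alpha> k * (h (y k) - h \<theta>))"
    and agree: "\<And>i. (\<lambda>k. x i k - y k) \<longlonglongrightarrow> 0"
    and \<alpha>: "\<And>k. 0 \<le> \<alpha> k" "\<not> summable \<alpha>"
  shows "\<exists>\<theta>\<in>minimizers \<Omega> h. \<forall>i. x i \<longlonglongrightarrow> \<theta>"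
proof -
  define V where "V = (\<lambda>\<theta> k. \<Sum>i\<in>UNIV. (norm (x i k - \<theta>))\<^sup>2)"
  have V_ge: "(norm (x i k - \<theta>))\<^sup>2 \<le> V \<theta> k" for i k \<theta>
    unfolding V_def by (rule member_le_sum[of i UNIV "\<lambda>i. (norm (x i k - \<theta>))\<^sup>2"]) auto
  obtain q where q: "q \<in> Q" using Q by fastforce
  have q_min: "h q \<le> h z" if "z \<in> \<Omega>" for z using q Q(1) that by (auto simp: minimizers_def)
  have "\<exists>k\<ge>n. h (y k) - h q < inverse (real (Suc n))" for n
    by (rule frequently_small_of_weighted_summable[OF \<alpha> summ[OF q]]) simp
  then obtain \<kappa> where \<kappa>: "\<And>n. \<kappa> n \<ge> n" "\<And>n. h (y (\<kappa> n)) - h q < inverse (real (Suc n))"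
    by metis
  have y_bdd: "bounded (range y)"
  proof -
    \<comment> \<open>Any agent will do: its distance to \<open>q\<close> is bounded, and it stays
      within a bounded distance of \<open>y\<close>.\<close>
    obtain i :: 'i where True by simp
    have "Bseq (V q)" using conv[OF q] unfolding V_def by (rule convergent_imp_Bseq)
    then obtain B where B: "\<And>k. \<bar>V q k\<bar> \<le> B" by (auto simp: Bseq_def)
    have "norm (x i k - q) \<le> sqrt B" for k
      by (rule real_le_rsqrt) (use V_ge[where i=i and k=k and \<theta>=q] abs_le_D1[OF B[of k]] in linarith)
    moreover obtain B' where "\<And>k. norm (x i k - y k) \<le> B'"
      using convergent_imp_Bseq[OF convergentI[OF agree[of i]]] by (auto simp: Bseq_def)
    ultimately have "norm (y k) \<le> norm q + sqrt B + B'" for k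
      using norm_triangle_ineq[of "q + (x i k - q)" "- (x i k - y k)"] norm_triangle_ineq[of q "x i k - q"]
      by (simp add: norm_minus_commute) (smt (verit))
    then show ?thesis by (intro boundedI) auto
  qed
  then have "bounded (range (y \<circ> \<kappa>))" by (rule bounded_subset) auto
  then obtain z \<sigma> where \<sigma>: "strict_mono \<sigma>" and lim: "((y \<circ> \<kappa>) \<circ> \<sigma>) \<longlonglongrightarrow> z"
    using bounded_imp_convergent_subsequence by metis
  define r where "r = (\<lambda>n. \<kappa> (\<sigma> n))"
  have r_ge: "r n \<ge> n" for n using \<kappa>(1)[of "\<sigma> n"] seq_suble[OF \<sigma>, of n] by (simp add: r_def)
  \<comment> \<open>\<open>\<kappa>\<close> need not be monotone, but \<open>r n \<ge> n\<close> is
    enough to pass to limits along \<open>r\<close>.\<close>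
  have r: "filterlim r at_top sequentially"
    by (rule filterlim_at_top_mono[OF filterlim_ident]) (simp add: r_ge)
  have y_lim: "(\<lambda>n. y (r n)) \<longlonglongrightarrow> z" using lim by (simp add: r_def comp_def)
  have z: "z \<in> \<Omega>" by (rule closed_sequentially[OF \<Omega>(1) _ y_lim]) (rule \<Omega>(3))
  have "(\<lambda>n. h (y (r n))) \<longlonglongrightarrow> h z"
    using continuous_on_tendsto_compose[OF \<Omega>(2) y_lim z] \<Omega>(3) by simp
  moreover have "(\<lambda>n. h (y (r n))) \<longlonglongrightarrow> h q"
  proof (rule real_tendsto_sandwich)
    show "\<forall>\<^sub>F n in sequentially. h q \<le> h (y (r n))" using q_min \<Omega>(3) by simp
    have "inverse (real (Suc (\<sigma> n))) \<le> inverse (real (Suc n))" for n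
      using seq_suble[OF \<sigma>, of n] by (simp add: field_simps)
    then show "\<forall>\<^sub>F n in sequentially. h (y (r n)) \<le> h q + inverse (real (Suc n))"
      using \<kappa>(2)[of "\<sigma> _"] unfolding r_def by (intro always_eventually allI) (smt (verit))
    show "(\<lambda>n. h q + inverse (real (Suc n))) \<longlonglongrightarrow> h q"
      using tendsto_add[OF tendsto_const LIMSEQ_inverse_real_of_nat] by simp
  qed simp
  ultimately have "h z = h q" by (rule LIMSEQ_unique)
  with z q_min have z_min: "z \<in> minimizers \<Omega> h" by (auto simp: minimizers_def)
  have x_lim: "(\<lambda>n. x i (r n)) \<longlonglongrightarrow> z" for i
    using tendsto_add[OF filterlim_compose[OF agree r] y_lim, of i] by simp
  have "x i \<longlonglongrightarrow> z" for i
  proof (rule LIMSEQ_I)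
    fix \<epsilon> :: real assume \<epsilon>: "0 < \<epsilon>"
    define N where "N = real CARD('i)"
    have N: "1 \<le> N" by (simp add: N_def Suc_leI)
    \<comment> \<open>The final triangle inequality has two summands, each below
      \<open>N * \<epsilon>'\<close>; the factor \<open>N\<close> absorbs the number of agents
      summed in \<open>V\<close>.\<close>
    define \<epsilon>' where "\<epsilon>' = \<epsilon> / (2 * N)"
    have \<epsilon>': "0 < \<epsilon>'" using \<epsilon> N by (simp add: \<epsilon>'_def)
    obtain \<theta> where \<theta>: "\<theta> \<in> Q" "dist \<theta> z < \<epsilon>'"
      using Q(2) z_min \<epsilon>' by (meson closure_approachable subsetD)
    obtain L where L: "V \<theta> \<longlonglongrightarrow> L" using conv[OF \<theta>(1)] by (auto simp: V_def convergent_def)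
    have "(\<lambda>n. V \<theta> (r n)) \<longlonglongrightarrow> (\<Sum>i\<in>(UNIV :: 'i set). (norm (z - \<theta>))\<^sup>2)"
      unfolding V_def by (intro tendsto_intros x_lim)
    \<comment> \<open>The limit \<open>L\<close> exists along the full sequence, so its value may be
      computed along \<open>r\<close>, where every agent tends to \<open>z\<close>.\<close>
    with filterlim_compose[OF L r] have "L = N * (norm (z - \<theta>))\<^sup>2"
      by (auto dest: LIMSEQ_unique simp: N_def)
    moreover have "(norm (z - \<theta>))\<^sup>2 < \<epsilon>'\<^sup>2"
      using \<theta>(2) by (intro power_strict_mono) (auto simp: dist_norm norm_minus_commute)
    ultimately have "L < N * \<epsilon>'\<^sup>2" using N by simp
    also have "\<dots> \<le> (N * \<epsilon>')\<^sup>2" 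
      using mult_right_mono[OF N, of "N * \<epsilon>'\<^sup>2"] N by (simp add: power2_eq_square mult_ac)
    finally obtain k0 where k0: "\<And>k. k \<ge> k0 \<Longrightarrow> V \<theta> k < (N * \<epsilon>')\<^sup>2"
      using order_tendstoD(2)[OF L] by (auto simp: eventually_sequentially)
    have "norm (x i k - z) < \<epsilon>" if k: "k \<ge> k0" for k
    proof -
      have "(norm (x i k - \<theta>))\<^sup>2 < (N * \<epsilon>')\<^sup>2" using V_ge[where i=i and k=k and \<theta>=\<theta>] k0[OF k] by linarith
      then have "norm (x i k - \<theta>) < N * \<epsilon>'"
        by (rule power2_less_imp_less) (use N \<epsilon>' in simp)
      moreover have "norm (\<theta> - z) < N * \<epsilon>'"
        using \<theta>(2) mult_right_mono[OF N, of \<epsilon>'] \<epsilon>' unfolding dist_norm by linarith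
      moreover have "N * \<epsilon>' + N * \<epsilon>' = \<epsilon>" using N by (simp add: \<epsilon>'_def)
      ultimately show ?thesis using norm_triangle_ineq[of "x i k - \<theta>" "\<theta> - z"] by simp
    qed
    then show "\<exists>k0. \<forall>k\<ge>k0. norm (x i k - z) < \<epsilon>" by blast
  qed
  with z_min show ?thesis by blast
qed

section \<open>The algorithm\<close>

lemma noise_past_generators:
  assumes "\<And>i k. \<xi> i k \<in> borel_measurable M"
  shows "{\<xi> i m -` B \<inter> space M | i m B. m < k \<and> B \<in> sets borel} \<subseteq> sets M"
  using assms by (auto intro: measurable_sets)

lemma sets_noise_past:
  assumes "\<And>i k. \<xi> i k \<in> borel_measurable M"
  shows "sets (noise_past M \<xi> k)
    = sigma_sets (space M) {\<xi> i m -` B \<inter> space M | i m B. m < k \<and> B \<in> sets borel}"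
  unfolding noise_past_def by (rule sets_measure_of) auto

lemma space_noise_past [simp]: "space (noise_past M \<xi> k) = space M"
  unfolding noise_past_def by (rule space_measure_of) auto

lemma subalgebra_noise_past:
  assumes "\<And>i k. \<xi> i k \<in> borel_measurable M"
  shows "subalgebra M (noise_past M \<xi> k)"
  unfolding subalgebra_def sets_noise_past[OF assms]
  by (auto intro!: sets.sigma_sets_subset noise_past_generators assms)

lemma noise_past_mono:
  assumes "\<And>i k. \<xi> i k \<in> borel_measurable M"
  shows "subalgebra (noise_past M \<xi> (Suc k)) (noise_past M \<xi> k)"
  unfolding subalgebra_def sets_noise_past[OF assms]
  by (auto intro!: sigma_sets_mono' intro: less_SucI)

lemma measurable_noise_past:
  assumes "\<And>i k. \<xi> i k \<in> borel_measurable M"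
  shows "\<xi> i k \<in> borel_measurable (noise_past M \<xi> (Suc k))"
  by (rule measurableI) (auto simp: sets_noise_past[OF assms] intro!: sigma_sets.Basic)

text \<open>Of the step sizes and thresholds only positivity is fixed here, so that the one-step
  estimates are independent of the summability conditions, which enter when the steps are added
  up.\<close>

locale clipped_gradient_projection = prob_space M
  for M :: "'w measure" +
  fixes \<Omega> :: "(real ^ 'n) set"
    and f :: "'a::finite \<Rightarrow> real ^ 'n \<Rightarrow> real"
    and A :: "real ^ 'a ^ 'a"
    and \<xi> :: "'a \<Rightarrow> nat \<Rightarrow> 'w \<Rightarrow> real ^ 'n"
    and x v g ghat :: "'a \<Rightarrow> nat \<Rightarrow> 'w \<Rightarrow> real ^ 'n"
    and x0 :: "'a \<Rightarrow> real ^ 'n"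
    and \<alpha> \<tau> :: "nat \<Rightarrow> real"
    and C0 \<delta> \<nu> \<mu> :: real
  assumes A: "doubly_stochastic A"
    and loops: "\<And>i. i \<in> in_neighbours A i"
    and conn: "strongly_connected A"
    and \<Omega>: "\<Omega> \<noteq> {}" "closed \<Omega>" "convex \<Omega>"
    and diff: "\<And>i \<theta>. \<theta> \<in> \<Omega> \<Longrightarrow> f i differentiable (at \<theta>)"
    and grad_cont: "\<And>i. continuous_on \<Omega> (gradient (f i))"
    and conv: "\<And>i. convex_on \<Omega> (f i)"
    and grad_le: "\<And>i \<theta>. \<theta> \<in> \<Omega> \<Longrightarrow> norm (gradient (f i) \<theta>) \<le> C0"
    and \<mu>: "\<mu> = 0 \<or> (\<mu> > 0 \<and> (\<forall>i. strongly_convex \<mu> (f i)))"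
    and x0: "\<And>i. x0 i \<in> \<Omega>"
    and x_0: "\<And>i w. w \<in> space M \<Longrightarrow> x i 0 w = x0 i"
    and v: "\<And>i k w. w \<in> space M \<Longrightarrow> v i k w = (\<Sum>j\<in>UNIV. A $ i $ j *\<^sub>R x j k w)"
    and g: "\<And>i k w. w \<in> space M \<Longrightarrow> g i k w = gradient (f i) (v i k w) + \<xi> i k w"
    and ghat: "\<And>i k w. w \<in> space M \<Longrightarrow> ghat i k w = clip (\<tau> k) (g i k w)"
    and x_Suc: "\<And>i k w. w \<in> space M \<Longrightarrow>
           x i (Suc k) w = closest_point \<Omega> (v i k w - \<alpha> k *\<^sub>R ghat i k w)"
    and \<xi>: "\<And>i k. \<xi> i k \<in> borel_measurable M"
    and \<delta>: "1 < \<delta>"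
    and moment: "\<And>i k. AE w in M. nn_cond_exp M (noise_past M \<xi> k)
           (\<lambda>w'. ennreal (norm (\<xi> i k w') powr \<delta>)) w \<le> ennreal (\<nu> powr \<delta>)"
    and centred: "\<And>i k. AE w in M. vec_cond_exp M (noise_past M \<xi> k) (\<xi> i k) w = 0"
    and \<alpha>: "\<And>k. \<alpha> k > 0" and \<tau>: "\<And>k. \<tau> k > 0"
begin

abbreviation F :: "nat \<Rightarrow> 'w measure" where
  "F k \<equiv> noise_past M \<xi> k"

lemmas F_sub = subalgebra_noise_past[where \<xi>=\<xi>, OF \<xi>]
  and F_mono = noise_past_mono[where \<xi>=\<xi>, OF \<xi>]

section \<open>Feasibility, boundedness and adaptedness of the iterates\<close>

lemma x_mem: "w \<in> space M \<Longrightarrow> x i k w \<in> \<Omega>"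
  by (cases k) (simp_all add: x_0 x0 x_Suc closest_point_in_set \<Omega>)

lemma v_mem:
  assumes w: "w \<in> space M"
  shows "v i k w \<in> \<Omega>"
  unfolding v[OF w] by (rule convex_sum) (auto simp: \<Omega>(3) x_mem[OF w] doubly_stochasticD[OF A])

lemma ghat_le: "w \<in> space M \<Longrightarrow> norm (ghat i k w) \<le> \<tau> k"
  using \<tau>[of k] by (simp add: ghat norm_clip_le)

text \<open>The average \<open>v\<close> is in \<open>\<Omega>\<close> and thus its own projection,
  so nonexpansiveness bounds the displacement by the clipped step. The bound holds on every path,
  whatever the noise.\<close>

lemma step_le:
  assumes w: "w \<in> space M"
  shows "norm (x i (Suc k) w - v i k w) \<le> \<alpha> k * \<tau> k"
proof -
  have "dist (x i (Suc k) w) (closest_point \<Omega> (v i k w)) \<le> dist (v i k w - \<alpha> k *\<^sub>R ghat i k w) (v i k w)"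
    unfolding x_Suc[OF w] by (rule closest_point_lipschitz) (use \<Omega> in auto)
  also have "\<dots> \<le> \<alpha> k * \<tau> k"
    using \<alpha>[of k] ghat_le[OF w, of i k] by (simp add: dist_norm mult_left_mono)
  finally show ?thesis using closest_point_self[OF v_mem[OF w]] by (simp add: dist_norm)
qed

lemma norm_v_le:
  assumes w: "w \<in> space M" and le: "\<And>j. norm (x j k w - c) \<le> B"
  shows "norm (v i k w - c) \<le> B"
proof -
  have "v i k w - c = (\<Sum>j\<in>UNIV. A $ i $ j *\<^sub>R (x j k w - c))"
    by (simp add: v[OF w] doubly_stochastic_diff[OF A])
  also have "norm \<dots> \<le> (\<Sum>j\<in>UNIV. A $ i $ j * B)"
    by (rule sum_norm_le) (simp add: doubly_stochasticD(1)[OF A] mult_left_mono le)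
  finally show ?thesis by (simp add: sum_distrib_right[symmetric] doubly_stochasticD(3)[OF A])
qed

lemma sum_v_le:
  assumes w: "w \<in> space M"
  shows "(\<Sum>i\<in>UNIV. (norm (v i k w - c))\<^sup>2) \<le> (\<Sum>i\<in>UNIV. (norm (x i k w - c))\<^sup>2)"
  using doubly_stochastic_norm_le[OF A, of "\<lambda>j. x j k w - c"]
  by (simp add: v[OF w] doubly_stochastic_diff[OF A])

text \<open>The bound depends on \<open>k\<close> and is used for integrability at a fixed time; it
  says nothing uniform in time.\<close>

lemma x_bounded: "\<exists>B. \<forall>i. \<forall>w\<in>space M. norm (x i k w) \<le> B"
proof (induction k)
  case 0
  have "norm (x i 0 w) \<le> (\<Sum>j\<in>UNIV. norm (x0 j))" if "w \<in> space M" for i w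
    unfolding x_0[OF that] by (rule member_le_sum) auto
  then show ?case by blast
next
  case (Suc k)
  then obtain B where B: "\<And>i w. w \<in> space M \<Longrightarrow> norm (x i k w) \<le> B" by blast
  have "norm (x i (Suc k) w) \<le> B + \<alpha> k * \<tau> k" if w: "w \<in> space M" for i w
    using norm_v_le[OF w, of k 0 B i] B[OF w] step_le[OF w, of i k]
      norm_triangle_ineq[of "v i k w" "x i (Suc k) w - v i k w"] by simp
  then show ?case by blast
qed

text \<open>The gradient is continuous on \<open>\<Omega>\<close> only, hence the detour through the
  restricted Borel space.\<close>

lemma gradient_measurable:
  assumes u: "u \<in> borel_measurable N" "\<And>w. w \<in> space N \<Longrightarrow> u w \<in> \<Omega>"
  shows "(\<lambda>w. gradient (f i) (u w)) \<in> borel_measurable N"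
proof -
  have "u \<in> measurable N (restrict_space borel \<Omega>)"
    by (rule measurable_restrict_space2) (use u in auto)
  from measurable_compose[OF this borel_measurable_continuous_on_restrict[OF grad_cont]]
  show ?thesis .
qed

lemma v_measurable_step:
  assumes "\<And>j. x j k \<in> borel_measurable (F k)"
  shows "v i k \<in> borel_measurable (F k)"
proof -
  have "(\<lambda>w. \<Sum>j\<in>UNIV. A $ i $ j *\<^sub>R x j k w) \<in> borel_measurable (F k)"
    using assms by measurable
  then show ?thesis by (rule measurable_cong[THEN iffD1, rotated]) (simp add: v)
qed

lemma ghat_measurable_step:
  assumes "v i k \<in> borel_measurable (F k)"
  shows "ghat i k \<in> borel_measurable (F (Suc k))"
proof -
  note measurable_from_subalg[OF F_mono gradient_measurable[OF assms v_mem], measurable]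
  note measurable_noise_past[where \<xi>=\<xi>, OF \<xi>, measurable]
  have "(\<lambda>w. clip (\<tau> k) (gradient (f i) (v i k w) + \<xi> i k w)) \<in> borel_measurable (F (Suc k))"
    unfolding clip_def by simp
  then show ?thesis by (rule measurable_cong[THEN iffD1, rotated]) (simp add: ghat g)
qed

lemma x_measurable: "x i k \<in> borel_measurable (F k)"
proof (induction k arbitrary: i)
  case 0
  have "(\<lambda>w. x0 i) \<in> borel_measurable (F 0)" by simp
  then show ?case by (rule measurable_cong[THEN iffD1, rotated]) (simp add: x_0)
next
  case (Suc k)
  note vk = v_measurable_step[OF Suc]
  note measurable_from_subalg[OF F_mono vk, measurable] ghat_measurable_step[OF vk, measurable]
  have "(\<lambda>w. v i k w - \<alpha> k *\<^sub>R ghat i k w) \<in> borel_measurable (F (Suc k))" by simp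
  then have "(\<lambda>w. closest_point \<Omega> (v i k w - \<alpha> k *\<^sub>R ghat i k w)) \<in> borel_measurable (F (Suc k))"
    by (rule borel_measurable_continuous_on[OF continuous_on_closest_point[OF \<Omega>(3,2,1)]])
  then show ?case by (rule measurable_cong[THEN iffD1, rotated]) (simp add: x_Suc)
qed

lemmas v_measurable = v_measurable_step[OF x_measurable]
  and ghat_measurable = ghat_measurable_step[OF v_measurable_step[OF x_measurable]]

text \<open>Unites both regimes: for \<open>\<mu> = 0\<close> it is convexity on
  \<open>\<Omega>\<close>, otherwise the global strong convexity restricted to
  \<open>\<Omega>\<close>.\<close>

lemma strong_gradient_inequality:
  assumes "y \<in> \<Omega>" "z \<in> \<Omega>"
  shows "gradient (f i) y \<bullet> (z - y) + \<mu> / 2 * (norm (z - y))\<^sup>2 \<le> f i z - f i y"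
  using \<mu> convex_on_gradient_inequality[OF conv assms diff[OF assms(1)]]
  by (auto simp: strongly_convex_def)

lemma mean_mem: "w \<in> space M \<Longrightarrow> mean (\<lambda>i. x i k w) \<in> \<Omega>"
  unfolding mean_def scaleR_sum_right by (rule convex_sum) (auto simp: \<Omega>(3) x_mem)

text \<open>Linearizing each \<open>f i\<close> at the common mean keeps the error first order in
  the disagreement: \<open>v i\<close> is a convex combination of points within \<open>D\<close> of
  the mean, and the gradient at the mean is at most \<open>C0\<close>.\<close>

lemma objective_gap:
  assumes w: "w \<in> space M" and D: "disagreement (\<lambda>i. x i k w) \<le> D"
  shows "(\<Sum>i\<in>UNIV. f i (mean (\<lambda>i. x i k w))) - real CARD('a) * (C0 * D) \<le> (\<Sum>i\<in>UNIV. f i (v i k w))"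
proof -
  define m where "m = mean (\<lambda>i. x i k w)"
  have m: "m \<in> \<Omega>" unfolding m_def by (rule mean_mem[OF w])
  have "f i m - C0 * D \<le> f i (v i k w)" for i
  proof -
    have "norm (x j k w - m) \<le> D" for j
      using norm_diff_mean_le[of "\<lambda>i. x i k w" j] D by (simp add: m_def)
    then have "norm (v i k w - m) \<le> D" by (rule norm_v_le[OF w])
    moreover have C0: "0 \<le> C0" using grad_le[OF m, of i] norm_ge_zero order_trans by blast
    ultimately have "norm (gradient (f i) m) * norm (v i k w - m) \<le> C0 * D"
      using grad_le[OF m] by (intro mult_mono) auto
    moreover have "gradient (f i) m \<bullet> (v i k w - m) \<le> f i (v i k w) - f i m"
      by (rule convex_on_gradient_inequality[OF conv m v_mem[OF w] diff[OF m]])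
    ultimately show ?thesis
      using Cauchy_Schwarz_ineq2[of "gradient (f i) m" "v i k w - m"] by linarith
  qed
  then have "(\<Sum>i\<in>(UNIV :: 'a set). f i m - C0 * D) \<le> (\<Sum>i\<in>UNIV. f i (v i k w))"
    by (rule sum_mono)
  then show ?thesis by (simp add: sum_subtractf m_def)
qed

lemma disagreement_majorant:
  assumes dec: "decseq \<alpha>" and sq: "summable (\<lambda>k. (\<alpha> k)\<^sup>2)" "summable (\<lambda>k. (\<alpha> k)\<^sup>2 * (\<tau> k)\<^sup>2)"
  obtains D where "\<And>k. 0 \<le> D k" "\<And>k w. w \<in> space M \<Longrightarrow> disagreement (\<lambda>i. x i k w) \<le> D k"
    "summable (\<lambda>k. \<alpha> k * D k)" "D \<longlonglongrightarrow> 0"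
proof -
  obtain r where r: "0 \<le> r" "r < 1" and contr: "\<And>y :: 'a \<Rightarrow> real ^ 'n. (\<Sum>j\<in>UNIV. y j) = 0 \<Longrightarrow>
    (\<Sum>i\<in>UNIV. (norm (\<Sum>j\<in>UNIV. A $ i $ j *\<^sub>R y j))\<^sup>2) \<le> r * (\<Sum>j\<in>UNIV. (norm (y j))\<^sup>2)"
    using doubly_stochastic_contraction[OF A loops conn, where 'b="real ^ 'n"] by blast
  define b where "b = (\<lambda>k. 2 * real CARD('a) * (\<alpha> k * \<tau> k))"
  \<comment> \<open>The recursion of \<open>disagreement_step\<close> taken with equality. Its input
    is the pathwise step bound, which is why \<open>D\<close> does not depend on the
    outcome.\<close>
  define D where "D = rec_nat (disagreement x0) (\<lambda>k d. sqrt r * d + b k)"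
  have D_Suc: "D (Suc k) = sqrt r * D k + b k" for k by (simp add: D_def)
  have b0: "0 \<le> b k" for k using \<alpha>[of k] \<tau>[of k] by (simp add: b_def)
  have D0: "0 \<le> D k" for k
    by (induction k) (simp_all add: D_Suc b0 r, simp add: D_def disagreement_nonneg)
  have dis: "disagreement (\<lambda>i. x i k w) \<le> D k" if w: "w \<in> space M" for k w
  proof (induction k)
    case 0
    then show ?case by (simp add: D_def x_0[OF w])
  next
    case (Suc k)
    have "x i (Suc k) w = (\<Sum>j\<in>UNIV. A $ i $ j *\<^sub>R x j k w) + (x i (Suc k) w - v i k w)" for i
      by (simp add: v[OF w])
    then have "disagreement (\<lambda>i. x i (Suc k) w)
        = disagreement (\<lambda>i. (\<Sum>j\<in>UNIV. A $ i $ j *\<^sub>R x j k w) + (x i (Suc k) w - v i k w))"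
      by (simp only: )
    also have "\<dots> \<le> sqrt r * disagreement (\<lambda>i. x i k w) + b k"
      unfolding b_def by (rule disagreement_step[OF A contr step_le[OF w]])
    also have "\<dots> \<le> D (Suc k)" using Suc r(1) by (simp add: D_Suc mult_left_mono)
    finally show ?case .
  qed
  have "summable (\<lambda>k. (b k)\<^sup>2)"
    using summable_mult[OF sq(2), of "(2 * real CARD('a))\<^sup>2"]
    by (simp add: b_def power_mult_distrib mult_ac)
  moreover have "0 \<le> sqrt r" "sqrt r < 1" using r by auto
  ultimately have "summable (\<lambda>k. \<alpha> k * D k)" "D \<longlonglongrightarrow> 0"
    using geometric_recursion[of D "sqrt r" b \<alpha>] D0 D_Suc b0 dec sq(1) less_imp_le[OF \<alpha>] by auto
  with that D0 dis show ?thesis by blast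
qed

section \<open>Drift and martingale part of the Lyapunov function\<close>

definition correlation :: "real ^ 'n \<Rightarrow> 'a \<Rightarrow> nat \<Rightarrow> 'w \<Rightarrow> real" where
  "correlation \<theta> i k w = ghat i k w \<bullet> (v i k w - \<theta>)"

text \<open>Expanding the squared distance after a step produces \<open>-2 * \<alpha> k\<close>
  times the correlation. Replacing the correlation by its conditional expectation leaves this
  centred remainder, which explains the order of the difference.\<close>

definition martingale_part :: "real ^ 'n \<Rightarrow> nat \<Rightarrow> 'w \<Rightarrow> real" where
  "martingale_part \<theta> k w =
    2 * \<alpha> k * (\<Sum>i\<in>UNIV. real_cond_exp M (F k) (correlation \<theta> i k) w - correlation \<theta> i k w)"

definition lyapunov :: "real ^ 'n \<Rightarrow> nat \<Rightarrow> 'w \<Rightarrow> real" where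
  "lyapunov \<theta> k w = (\<Sum>i\<in>UNIV. (norm (x i k w - \<theta>))\<^sup>2)"

lemma correlation_measurable: "correlation \<theta> i k \<in> borel_measurable (F (Suc k))"
proof -
  note measurable_from_subalg[OF F_mono v_measurable, measurable] ghat_measurable[measurable]
  show ?thesis unfolding correlation_def by simp
qed

lemma correlation_le:
  assumes w: "w \<in> space M"
  shows "\<bar>correlation \<theta> i k w\<bar> \<le> \<tau> k * norm (v i k w - \<theta>)"
proof -
  have "\<bar>correlation \<theta> i k w\<bar> \<le> norm (ghat i k w) * norm (v i k w - \<theta>)"
    unfolding correlation_def by (rule Cauchy_Schwarz_ineq2)
  also have "\<dots> \<le> \<tau> k * norm (v i k w - \<theta>)" by (intro mult_right_mono ghat_le w) simp
  finally show ?thesis .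
qed

lemma v_bounded: "\<exists>B. \<forall>i. \<forall>w\<in>space M. norm (v i k w - \<theta>) \<le> B"
proof -
  obtain B where B: "\<And>i w. w \<in> space M \<Longrightarrow> norm (x i k w) \<le> B" using x_bounded by blast
  have "norm (v i k w - \<theta>) \<le> B + norm \<theta>" if w: "w \<in> space M" for i w
  proof (rule norm_v_le[OF w])
    show "norm (x j k w - \<theta>) \<le> B + norm \<theta>" for j
      using B[OF w, of j] norm_triangle_ineq4[of "x j k w" \<theta>] by linarith
  qed
  then show ?thesis by blast
qed

lemma norm_v_integrable: "integrable M (\<lambda>w. norm (v i k w - \<theta>))"
proof -
  obtain B where "\<And>w. w \<in> space M \<Longrightarrow> norm (v i k w - \<theta>) \<le> B" using v_bounded by blast
  moreover note measurable_from_subalg[OF F_sub v_measurable, measurable]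
  ultimately show ?thesis by (intro integrable_const_bound[of _ B]) auto
qed

lemma correlation_integrable: "integrable M (correlation \<theta> i k)"
proof (rule Bochner_Integration.integrable_bound)
  show "integrable M (\<lambda>w. \<tau> k * norm (v i k w - \<theta>))" by (simp add: norm_v_integrable)
  show "correlation \<theta> i k \<in> borel_measurable M"
    by (rule measurable_from_subalg[OF F_sub correlation_measurable])
  show "AE w in M. norm (correlation \<theta> i k w) \<le> norm (\<tau> k * norm (v i k w - \<theta>))"
    by (rule AE_I2) (use correlation_le in \<open>auto intro: order_trans[OF _ abs_ge_self]\<close>)
qed

text \<open>The pathwise bound is itself known at time \<open>k\<close>, so conditioning leaves it
  unchanged.\<close>

lemma cond_exp_correlation_le:
  "AE w in M. \<bar>real_cond_exp M (F k) (correlation \<theta> i k) w\<bar> \<le> \<tau> k * norm (v i k w - \<theta>)"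
proof -
  interpret S: finite_measure_subalgebra M "F k" by unfold_locales (rule F_sub)
  define B where "B = (\<lambda>w. \<tau> k * norm (v i k w - \<theta>))"
  note v_measurable[measurable]
  have BF: "B \<in> borel_measurable (F k)" unfolding B_def by simp
  have B_int: "integrable M B" unfolding B_def by (simp add: norm_v_integrable)
  have neg: "integrable M (\<lambda>w. - B w)" using B_int by simp
  have le: "\<bar>correlation \<theta> i k w\<bar> \<le> B w" if "w \<in> space M" for w
    unfolding B_def by (rule correlation_le[OF that])
  have "AE w in M. real_cond_exp M (F k) (correlation \<theta> i k) w \<le> real_cond_exp M (F k) B w"
    by (rule S.real_cond_exp_mono) (use le in \<open>auto intro: B_int correlation_integrable simp: abs_le_iff\<close>)
  moreover have "AE w in M. real_cond_exp M (F k) (\<lambda>w. - B w) w \<le> real_cond_exp M (F k) (correlation \<theta> i k) w"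
    by (rule S.real_cond_exp_mono[OF AE_I2 neg correlation_integrable]) (use abs_le_D2[OF le] in force)
  moreover have "AE w in M. real_cond_exp M (F k) B w = B w"
    by (rule S.real_cond_exp_F_meas[OF B_int BF])
  moreover have "AE w in M. real_cond_exp M (F k) (\<lambda>w. - B w) w = - B w"
    by (rule S.real_cond_exp_F_meas[OF neg]) (use BF in simp)
  ultimately show ?thesis unfolding B_def by eventually_elim (simp add: abs_le_iff)
qed

lemma martingale_part_measurable: "martingale_part \<theta> k \<in> borel_measurable (F (Suc k))"
proof -
  note measurable_from_subalg[OF F_mono borel_measurable_cond_exp, measurable]
    correlation_measurable[measurable]
  show ?thesis unfolding martingale_part_def[abs_def] by simp
qed

lemma martingale_part_cond_exp: "AE w in M. real_cond_exp M (F k) (martingale_part \<theta> k) w = 0"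
proof -
  interpret S: finite_measure_subalgebra M "F k" by unfold_locales (rule F_sub)
  define E where "E = (\<lambda>i. real_cond_exp M (F k) (correlation \<theta> i k))"
  have eq: "martingale_part \<theta> k = (\<lambda>w. 2 * \<alpha> k * (\<Sum>i\<in>UNIV. E i w - correlation \<theta> i k w))"
    by (simp add: fun_eq_iff martingale_part_def E_def)
  have E_int: "integrable M (E i)" for i
    unfolding E_def by (rule S.real_cond_exp_int(1)[OF correlation_integrable])
  have diff_int: "integrable M (\<lambda>w. E i w - correlation \<theta> i k w)" for i
    using E_int correlation_integrable by simp
  have "AE w in M. real_cond_exp M (F k) (\<lambda>w. E i w - correlation \<theta> i k w) w = 0" for i
  proof -
    have "AE w in M. real_cond_exp M (F k) (E i) w = E i w"
      by (rule S.real_cond_exp_F_meas[OF E_int]) (simp add: E_def)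
    with S.real_cond_exp_diff[OF E_int correlation_integrable[of \<theta> i k], of i] show ?thesis
      by eventually_elim (simp add: E_def)
  qed
  then have "AE w in M. \<forall>i. real_cond_exp M (F k) (\<lambda>w. E i w - correlation \<theta> i k w) w = 0"
    by (subst AE_all_countable) auto
  moreover have "AE w in M. real_cond_exp M (F k) (\<lambda>w. \<Sum>i\<in>UNIV. E i w - correlation \<theta> i k w) w
      = (\<Sum>i\<in>UNIV. real_cond_exp M (F k) (\<lambda>w. E i w - correlation \<theta> i k w) w)"
    by (rule S.real_cond_exp_sum[OF diff_int])
  moreover have "AE w in M. real_cond_exp M (F k) (\<lambda>w. 2 * \<alpha> k * (\<Sum>i\<in>UNIV. E i w - correlation \<theta> i k w)) w
      = 2 * \<alpha> k * real_cond_exp M (F k) (\<lambda>w. \<Sum>i\<in>UNIV. E i w - correlation \<theta> i k w) w"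
    by (rule S.real_cond_exp_cmult) (use diff_int in simp)
  ultimately have "AE w in M. real_cond_exp M (F k) (\<lambda>w. 2 * \<alpha> k * (\<Sum>i\<in>UNIV. E i w - correlation \<theta> i k w)) w = 0"
    by eventually_elim simp
  then show ?thesis by (simp add: eq)
qed

text \<open>In the constant 16, one factor 4 is the square of 2 in \<open>2 * \<alpha> k\<close>,
  the other comes from bounding the correlation and its conditional expectation by the same
  quantity. \<open>CARD('a)\<close> is due to Cauchy-Schwarz over the agents.\<close>

lemma martingale_part_variance:
  "AE w in M. (martingale_part \<theta> k w)\<^sup>2 \<le> (16 * real CARD('a) * ((\<alpha> k)\<^sup>2 * (\<tau> k)\<^sup>2)) * lyapunov \<theta> k w"
proof -
  have "AE w in M. \<forall>i. \<bar>real_cond_exp M (F k) (correlation \<theta> i k) w\<bar> \<le> \<tau> k * norm (v i k w - \<theta>)"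
    by (subst AE_all_countable) (auto intro: cond_exp_correlation_le)
  moreover have "AE w in M. w \<in> space M" by (rule AE_space)
  ultimately show ?thesis
  proof eventually_elim
    case (elim w)
    define d where "d = (\<lambda>i. real_cond_exp M (F k) (correlation \<theta> i k) w - correlation \<theta> i k w)"
    have "(d i)\<^sup>2 \<le> (2 * \<tau> k * norm (v i k w - \<theta>))\<^sup>2" for i
    proof -
      have "\<bar>d i\<bar> \<le> 2 * \<tau> k * norm (v i k w - \<theta>)"
        using spec[OF elim(1), of i] correlation_le[OF elim(2), of \<theta> i k] unfolding d_def by linarith
      then show ?thesis using power_mono[of "\<bar>d i\<bar>" _ 2] by simp
    qed
    then have "(\<Sum>i\<in>UNIV. (d i)\<^sup>2) \<le> (\<Sum>i\<in>UNIV. (2 * \<tau> k)\<^sup>2 * (norm (v i k w - \<theta>))\<^sup>2)"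
      by (intro sum_mono) (simp add: power_mult_distrib)
    also have "\<dots> \<le> (2 * \<tau> k)\<^sup>2 * lyapunov \<theta> k w"
      unfolding lyapunov_def sum_distrib_left[symmetric]
      by (intro mult_left_mono sum_v_le elim) simp
    finally have le: "(\<Sum>i\<in>UNIV. (d i)\<^sup>2) \<le> (2 * \<tau> k)\<^sup>2 * lyapunov \<theta> k w" .
    have "(\<Sum>i\<in>UNIV. d i)\<^sup>2 \<le> (\<Sum>i\<in>UNIV. (d i)\<^sup>2) * real CARD('a)"
      by (rule sum_squared_le_sum_of_squares)
    also have "\<dots> \<le> ((2 * \<tau> k)\<^sup>2 * lyapunov \<theta> k w) * real CARD('a)"
      using le by (rule mult_right_mono) simp
    finally have "(\<Sum>i\<in>UNIV. d i)\<^sup>2 \<le> ((2 * \<tau> k)\<^sup>2 * lyapunov \<theta> k w) * real CARD('a)" .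
    then have "(2 * \<alpha> k)\<^sup>2 * (\<Sum>i\<in>UNIV. d i)\<^sup>2 \<le> (2 * \<alpha> k)\<^sup>2 * (((2 * \<tau> k)\<^sup>2 * lyapunov \<theta> k w) * real CARD('a))"
      by (rule mult_left_mono) simp
    then show ?case
      unfolding martingale_part_def d_def[symmetric] by (simp add: power_mult_distrib mult_ac)
  qed
qed

lemma cond_exp_correlation_lower:
  assumes \<theta>: "\<theta> \<in> \<Omega>" and \<tau>k: "2 * C0 \<le> \<tau> k"
  defines "B \<equiv> \<nu> powr \<delta> * (\<tau> k / 2) powr (1 - \<delta>)"
  shows "AE w in M. f i (v i k w) - f i \<theta> + \<mu> / 2 * (norm (v i k w - \<theta>))\<^sup>2 - B * norm (v i k w - \<theta>)
    \<le> real_cond_exp M (F k) (correlation \<theta> i k) w"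
proof -
  interpret S: finite_measure_subalgebra M "F k" by unfold_locales (rule F_sub)
  obtain K where K: "\<And>w. w \<in> space M \<Longrightarrow> norm (v i k w - \<theta>) \<le> K" using v_bounded by blast
  define H where "H = (\<lambda>w. clip (\<tau> k) (gradient (f i) (v i k w) + \<xi> i k w) \<bullet> (v i k w - \<theta>))"
  have H_eq: "correlation \<theta> i k w = H w" if "w \<in> space M" for w
    using that by (simp add: correlation_def H_def ghat g)
  have cM: "correlation \<theta> i k \<in> borel_measurable M"
    by (rule borel_measurable_integrable[OF correlation_integrable])
  have "AE w in M. gradient (f i) (v i k w) \<bullet> (v i k w - \<theta>) - B * norm (v i k w - \<theta>)
      \<le> real_cond_exp M (F k) H w"
    unfolding H_def B_def
  proof (rule clip_cond_exp_lower[OF F_sub _ _ _ K \<xi> \<tau> \<delta> moment centred])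
    show "(\<lambda>w. gradient (f i) (v i k w)) \<in> borel_measurable (F k)"
      by (rule gradient_measurable[OF v_measurable v_mem]) simp_all
    show "2 * norm (gradient (f i) (v i k w)) \<le> \<tau> k" if w: "w \<in> space M" for w
      using grad_le[OF v_mem[OF w, of i k], of i] \<tau>k by linarith
    show "(\<lambda>w. v i k w - \<theta>) \<in> borel_measurable (F k)" using v_measurable[measurable] by simp
  qed
  \<comment> \<open>The algorithm is prescribed on \<open>space M\<close> only, so the two functions
    may differ elsewhere and a congruence is required.\<close>
  moreover have "AE w in M. real_cond_exp M (F k) (correlation \<theta> i k) w = real_cond_exp M (F k) H w"
  proof (rule S.real_cond_exp_cong[OF _ cM])
    show "AE w in M. correlation \<theta> i k w = H w" by (rule AE_I2) (rule H_eq)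
    show "H \<in> borel_measurable M" using cM by (rule measurable_cong[THEN iffD1, rotated]) (rule H_eq)
  qed
  moreover have "AE w in M. w \<in> space M" by (rule AE_space)
  ultimately show ?thesis
  proof eventually_elim
    case (elim w)
    show ?case
      using strong_gradient_inequality[OF v_mem[OF elim(3), of i k] \<theta>, of i] elim(1,2)
        inner_minus_right[of "gradient (f i) (v i k w)" "\<theta> - v i k w"]
      by (simp add: norm_minus_commute)
  qed
qed

text \<open>Since \<open>\<theta>\<close> is in \<open>\<Omega>\<close>, projecting does not
  increase the distance to it; the rest is the expansion of a square with the clipped gradient
  bounded by \<open>\<tau> k\<close>.\<close>

lemma lyapunov_step:
  assumes w: "w \<in> space M" and \<theta>: "\<theta> \<in> \<Omega>"
  shows "lyapunov \<theta> (Suc k) w \<le> (\<Sum>i\<in>UNIV. (norm (v i k w - \<theta>))\<^sup>2)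
    - 2 * \<alpha> k * (\<Sum>i\<in>UNIV. correlation \<theta> i k w) + real CARD('a) * ((\<alpha> k)\<^sup>2 * (\<tau> k)\<^sup>2)"
proof -
  have "(norm (x i (Suc k) w - \<theta>))\<^sup>2
      \<le> (norm (v i k w - \<theta>))\<^sup>2 - 2 * \<alpha> k * correlation \<theta> i k w + (\<alpha> k)\<^sup>2 * (\<tau> k)\<^sup>2" for i
  proof -
    let ?z = "v i k w - \<alpha> k *\<^sub>R ghat i k w"
    have "dist (closest_point \<Omega> ?z) (closest_point \<Omega> \<theta>) \<le> dist ?z \<theta>"
      by (rule closest_point_lipschitz) (use \<Omega> in auto)
    then have "(norm (x i (Suc k) w - \<theta>))\<^sup>2 \<le> (norm (?z - \<theta>))\<^sup>2"
      by (intro power_mono) (simp_all add: x_Suc[OF w] closest_point_self[OF \<theta>] dist_norm)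
    also have "?z - \<theta> = (v i k w - \<theta>) - \<alpha> k *\<^sub>R ghat i k w" by simp
    also have "(norm \<dots>)\<^sup>2 = (norm (v i k w - \<theta>))\<^sup>2 - 2 * \<alpha> k * correlation \<theta> i k w + (\<alpha> k)\<^sup>2 * (norm (ghat i k w))\<^sup>2"
      unfolding correlation_def power2_norm_eq_inner
      by (simp add: inner_diff_left inner_diff_right inner_commute power2_eq_square algebra_simps)
    also have "(\<alpha> k)\<^sup>2 * (norm (ghat i k w))\<^sup>2 \<le> (\<alpha> k)\<^sup>2 * (\<tau> k)\<^sup>2"
      by (intro mult_left_mono power_mono ghat_le w) auto
    finally show ?thesis by simp
  qed
  then have "lyapunov \<theta> (Suc k) w
      \<le> (\<Sum>i\<in>UNIV. (norm (v i k w - \<theta>))\<^sup>2 - 2 * \<alpha> k * correlation \<theta> i k w + (\<alpha> k)\<^sup>2 * (\<tau> k)\<^sup>2)"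
    unfolding lyapunov_def by (rule sum_mono)
  then show ?thesis by (simp add: sum.distrib sum_subtractf sum_distrib_left)
qed

lemma lyapunov_recursion:
  assumes \<theta>: "\<theta> \<in> \<Omega>" and \<tau>k: "2 * C0 \<le> \<tau> k" and p: "0 < p"
    and D: "\<And>w. w \<in> space M \<Longrightarrow> disagreement (\<lambda>i. x i k w) \<le> D"
  defines "B \<equiv> \<nu> powr \<delta> * (\<tau> k / 2) powr (1 - \<delta>)"
    and "h \<equiv> \<lambda>y. \<Sum>i\<in>UNIV. f i y"
  shows "AE w in M. lyapunov \<theta> (Suc k) w \<le> (1 + max 0 (p - \<mu> * \<alpha> k)) * lyapunov \<theta> k w
    + real CARD('a) * ((\<alpha> k * B)\<^sup>2 / p + (\<alpha> k)\<^sup>2 * (\<tau> k)\<^sup>2 + 2 * C0 * (\<alpha> k * D))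
    - 2 * (\<alpha> k * (h (mean (\<lambda>i. x i k w)) - h \<theta>)) + martingale_part \<theta> k w"
proof -
  have "AE w in M. \<forall>i. f i (v i k w) - f i \<theta> + \<mu> / 2 * (norm (v i k w - \<theta>))\<^sup>2 - B * norm (v i k w - \<theta>)
    \<le> real_cond_exp M (F k) (correlation \<theta> i k) w"
    unfolding B_def by (subst AE_all_countable) (intro allI cond_exp_correlation_lower \<theta> \<tau>k)
  moreover have "AE w in M. w \<in> space M" by (rule AE_space)
  ultimately show ?thesis
  proof eventually_elim
    case (elim w)
    note w = elim(2)
    define N where "N = real CARD('a)"
    define u where "u = (\<lambda>i. norm (v i k w - \<theta>))"
    define U where "U = (\<Sum>i\<in>UNIV. (u i)\<^sup>2)"
    define E where "E = (\<lambda>i. real_cond_exp M (F k) (correlation \<theta> i k) w)"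
    have E: "2 * \<alpha> k * (f i (v i k w) - f i \<theta>) + (\<mu> * \<alpha> k - p) * (u i)\<^sup>2 - (\<alpha> k * B)\<^sup>2 / p
        \<le> 2 * \<alpha> k * E i" for i
    proof -
      \<comment> \<open>Young's inequality with weight \<open>p\<close>: the bias is linear in the
        distance and is traded for a quadratic term plus a remainder free of the iterates.\<close>
      have "0 \<le> (p * u i - \<alpha> k * B)\<^sup>2 / p" using p by simp
      also have "\<dots> = p * (u i)\<^sup>2 - 2 * (\<alpha> k * B * u i) + (\<alpha> k * B)\<^sup>2 / p"
        using p by (simp add: power2_diff divide_simps) (simp add: power2_eq_square algebra_simps)
      finally have "2 * (\<alpha> k * B * u i) \<le> p * (u i)\<^sup>2 + (\<alpha> k * B)\<^sup>2 / p" by simp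
      moreover have "2 * \<alpha> k * (f i (v i k w) - f i \<theta> + \<mu> / 2 * (u i)\<^sup>2 - B * u i) \<le> 2 * \<alpha> k * E i"
        unfolding u_def E_def using elim(1) \<alpha>[of k] by (intro mult_left_mono) auto
      ultimately show ?thesis by (simp add: algebra_simps)
    qed
    have "(\<Sum>i\<in>UNIV. 2 * \<alpha> k * (f i (v i k w) - f i \<theta>) + (\<mu> * \<alpha> k - p) * (u i)\<^sup>2 - (\<alpha> k * B)\<^sup>2 / p)
        \<le> (\<Sum>i\<in>UNIV. 2 * \<alpha> k * E i)"
      by (rule sum_mono) (rule E)
    then have sum_E: "2 * \<alpha> k * ((\<Sum>i\<in>UNIV. f i (v i k w)) - h \<theta>) + (\<mu> * \<alpha> k - p) * U - N * ((\<alpha> k * B)\<^sup>2 / p)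
        \<le> 2 * \<alpha> k * (\<Sum>i\<in>UNIV. E i)"
      by (simp add: sum.distrib sum_subtractf sum_distrib_left[symmetric] U_def h_def N_def)
    have mp: "martingale_part \<theta> k w = 2 * \<alpha> k * (\<Sum>i\<in>UNIV. E i) - 2 * \<alpha> k * (\<Sum>i\<in>UNIV. correlation \<theta> i k w)"
      by (simp add: martingale_part_def E_def sum_subtractf right_diff_distrib)
    have gap: "2 * \<alpha> k * (h (mean (\<lambda>i. x i k w)) - N * (C0 * D) - h \<theta>)
        \<le> 2 * \<alpha> k * ((\<Sum>i\<in>UNIV. f i (v i k w)) - h \<theta>)"
      using objective_gap[OF w D[OF w]] \<alpha>[of k] by (intro mult_left_mono) (auto simp: h_def N_def)
    \<comment> \<open>Strong convexity can make this coefficient very negative. Cutting it at 0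
      makes the total factor nonnegative, which allows \<open>U\<close> to be replaced by the larger
      Lyapunov value.\<close>
    have "(p - \<mu> * \<alpha> k) * U \<le> max 0 (p - \<mu> * \<alpha> k) * U"
      by (intro mult_right_mono) (auto simp: U_def sum_nonneg)
    then have "U + (p - \<mu> * \<alpha> k) * U \<le> (1 + max 0 (p - \<mu> * \<alpha> k)) * U" by (simp add: algebra_simps)
    also have "\<dots> \<le> (1 + max 0 (p - \<mu> * \<alpha> k)) * lyapunov \<theta> k w"
      unfolding U_def u_def lyapunov_def by (intro mult_left_mono sum_v_le w) simp
    finally have "U + (p - \<mu> * \<alpha> k) * U \<le> (1 + max 0 (p - \<mu> * \<alpha> k)) * lyapunov \<theta> k w" .
    with lyapunov_step[OF w \<theta>, of k] sum_E mp gap show ?case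
      unfolding U_def[symmetric, unfolded u_def] N_def[symmetric] by (simp add: algebra_simps)
  qed
qed

section \<open>Summing the recursion and identifying the limit\<close>

lemma bias_term_eq:
  assumes "0 < \<omega>"
  shows "(\<alpha> k * (\<nu> powr \<delta> * (\<tau> k / 2) powr (1 - \<delta>)))\<^sup>2 / (\<omega> * \<alpha> k powr \<omega>')
    = ((\<nu> powr \<delta>)\<^sup>2 / (\<omega> * 2 powr (2 - 2 * \<delta>))) * (\<alpha> k powr (2 - \<omega>') * \<tau> k powr (2 - 2 * \<delta>))"
proof -
  have "((\<tau> k / 2) powr (1 - \<delta>))\<^sup>2 = (\<tau> k / 2) powr (2 - 2 * \<delta>)"
    by (simp add: power2_eq_square powr_add[symmetric])
  also have "\<dots> = \<tau> k powr (2 - 2 * \<delta>) / 2 powr (2 - 2 * \<delta>)"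
    by (rule powr_divide)
  finally have "((\<tau> k / 2) powr (1 - \<delta>))\<^sup>2 = \<tau> k powr (2 - 2 * \<delta>) / 2 powr (2 - 2 * \<delta>)" .
  moreover have "\<alpha> k powr (2 - \<omega>') = (\<alpha> k)\<^sup>2 / \<alpha> k powr \<omega>'"
    using \<alpha>[of k] by (simp add: powr_diff)
  ultimately show ?thesis by (simp add: power_mult_distrib mult_ac)
qed

lemma AE_converges_to_minimizer:
  assumes min: "minimizers \<Omega> (\<lambda>\<theta>. \<Sum>i\<in>UNIV. f i \<theta>) \<noteq> {}"
    and dec: "decseq \<alpha>" and large: "\<And>k. k \<ge> k1 \<Longrightarrow> 2 * C0 \<le> \<tau> k" and C0: "0 \<le> C0"
    and div: "\<not> summable \<alpha>"
    and sq: "summable (\<lambda>k. (\<alpha> k)\<^sup>2)" "summable (\<lambda>k. (\<alpha> k)\<^sup>2 * (\<tau> k)\<^sup>2)"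
    and \<omega>: "0 < \<omega>" "series_less_infinity (\<lambda>k. \<omega> * \<alpha> k powr \<omega>' - \<mu> * \<alpha> k)"
    and bias: "summable (\<lambda>k. \<alpha> k powr (2 - \<omega>') * \<tau> k powr (2 - 2 * \<delta>))"
  shows "AE w in M. \<exists>\<theta>\<in>minimizers \<Omega> (\<lambda>\<theta>. \<Sum>i\<in>UNIV. f i \<theta>). \<forall>i. (\<lambda>k. x i k w) \<longlonglongrightarrow> \<theta>"
proof -
  define h where "h = (\<lambda>y. \<Sum>i\<in>UNIV. f i y)"
  define y where "y = (\<lambda>k w. mean (\<lambda>i. x i k w))"
  obtain D where D: "\<And>k. 0 \<le> D k" "\<And>k w. w \<in> space M \<Longrightarrow> disagreement (\<lambda>i. x i k w) \<le> D k"
    and D_summ: "summable (\<lambda>k. \<alpha> k * D k)" and D_lim: "D \<longlonglongrightarrow> 0"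
    using disagreement_majorant[OF dec sq] by blast
  define a where "a = (\<lambda>k. max 0 (\<omega> * \<alpha> k powr \<omega>' - \<mu> * \<alpha> k))"
  define b where "b = (\<lambda>k. 16 * real CARD('a) * ((\<alpha> k)\<^sup>2 * (\<tau> k)\<^sup>2))"
  define c where "c = (\<lambda>k. real CARD('a) * ((\<alpha> k * (\<nu> powr \<delta> * (\<tau> k / 2) powr (1 - \<delta>)))\<^sup>2 / (\<omega> * \<alpha> k powr \<omega>')
    + (\<alpha> k)\<^sup>2 * (\<tau> k)\<^sup>2 + 2 * C0 * (\<alpha> k * D k)))"
  have a: "summable a" "\<And>k. 0 \<le> a k"
    unfolding a_def using summable_positive_part[OF \<alpha> dec \<omega>] by simp_all
  have b: "summable b" "\<And>k. 0 \<le> b k"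
    unfolding b_def by (intro summable_mult sq) simp
  \<comment> \<open>By \<open>bias_term_eq\<close>, Young's remainder with weight
    \<open>\<omega> * \<alpha> k powr \<omega>'\<close> is a constant multiple of the term in the
    hypothesis \<open>bias\<close>.\<close>
  have c: "summable c"
    unfolding c_def bias_term_eq[OF \<omega>(1)] by (intro summable_mult summable_add bias sq D_summ)
  have c0: "0 \<le> c k" for k
    unfolding c_def using \<omega>(1) C0 D(1)[of k] less_imp_le[OF \<alpha>[of k]]
    by (intro mult_nonneg_nonneg add_nonneg_nonneg divide_nonneg_nonneg) auto
  have single: "AE w in M. convergent (\<lambda>k. lyapunov \<theta> k w) \<and> summable (\<lambda>k. \<alpha> k * (h (y k w) - h \<theta>))"
    if \<theta>: "\<theta> \<in> minimizers \<Omega> h" for \<theta>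
  proof -
    have \<theta>\<Omega>: "\<theta> \<in> \<Omega>" and \<theta>_min: "\<And>z. z \<in> \<Omega> \<Longrightarrow> h \<theta> \<le> h z" using \<theta> by (auto simp: minimizers_def)
    \<comment> \<open>The process is started at \<open>k1\<close>, since the bias estimate needs
      thresholds of at least \<open>2 * C0\<close>; neither convergence nor summability depends on
      the earlier steps.\<close>
    have "AE w in M. convergent (\<lambda>k. lyapunov \<theta> (k + k1) w)
        \<and> summable (\<lambda>k. 2 * (\<alpha> (k + k1) * (h (y (k + k1) w) - h \<theta>)))"
    proof (rule almost_supermartingale_convergence[where F="\<lambda>k. F (k + k1)"
          and s="\<lambda>k. martingale_part \<theta> (k + k1)" and a="\<lambda>k. a (k + k1)"
          and b="\<lambda>k. b (k + k1)" and c="\<lambda>k. c (k + k1)"])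
      show "integrable M (lyapunov \<theta> (k + k1))" for k
      proof -
        obtain B where B: "\<And>i w. w \<in> space M \<Longrightarrow> norm (x i (k + k1) w) \<le> B" using x_bounded by blast
        note measurable_from_subalg[OF F_sub x_measurable, measurable]
        have "integrable M (\<lambda>w. (norm (x i (k + k1) w - \<theta>))\<^sup>2)" for i
        proof (rule integrable_const_bound[of _ "(B + norm \<theta>)\<^sup>2"])
          show "AE w in M. norm ((norm (x i (k + k1) w - \<theta>))\<^sup>2) \<le> (B + norm \<theta>)\<^sup>2"
          proof (rule AE_I2)
            fix w assume w: "w \<in> space M"
            have "norm (x i (k + k1) w - \<theta>) \<le> B + norm \<theta>"
              using B[OF w, of i] norm_triangle_ineq4[of "x i (k + k1) w" \<theta>] by linarith
            then show "norm ((norm (x i (k + k1) w - \<theta>))\<^sup>2) \<le> (B + norm \<theta>)\<^sup>2"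
              by (simp add: power_mono)
          qed
        qed simp
        then show ?thesis unfolding lyapunov_def[abs_def] by simp
      qed
      show "0 \<le> lyapunov \<theta> (k + k1) w" for k w by (simp add: lyapunov_def sum_nonneg)
      show "0 \<le> 2 * (\<alpha> (k + k1) * (h (y (k + k1) w) - h \<theta>))" if "w \<in> space M" for k w
        using \<theta>_min[OF mean_mem[OF that, of "k + k1"]] \<alpha>[of "k + k1"] by (simp add: y_def)
      show "martingale_part \<theta> (k + k1) \<in> borel_measurable (F (Suc k + k1))" for k
        using martingale_part_measurable[of \<theta> "k + k1"] by simp
      show "AE w in M. lyapunov \<theta> (Suc k + k1) w \<le> (1 + a (k + k1)) * lyapunov \<theta> (k + k1) w + c (k + k1)
          - 2 * (\<alpha> (k + k1) * (h (y (k + k1) w) - h \<theta>)) + martingale_part \<theta> (k + k1) w" for k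
      proof -
        have "0 < \<omega> * \<alpha> (k + k1) powr \<omega>'" using \<omega>(1) \<alpha>[of "k + k1"] by simp
        from lyapunov_recursion[OF \<theta>\<Omega> large this D(2)] show ?thesis
          by (simp add: a_def c_def h_def y_def)
      qed
      show "AE w in M. (martingale_part \<theta> (k + k1) w)\<^sup>2 \<le> b (k + k1) * lyapunov \<theta> (k + k1) w" for k
        unfolding b_def by (rule martingale_part_variance)
    qed (use F_sub F_mono a b c c0 martingale_part_cond_exp in \<open>auto intro: summable_ignore_initial_segment\<close>)
    then show ?thesis
    proof eventually_elim
      case (elim w)
      have "summable (\<lambda>k. \<alpha> (k + k1) * (h (y (k + k1) w) - h \<theta>))"
        using elim summable_mult[of "\<lambda>k. 2 * (\<alpha> (k + k1) * (h (y (k + k1) w) - h \<theta>))" "1 / 2"] by simp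
      then have "summable (\<lambda>k. \<alpha> k * (h (y k w) - h \<theta>))"
        by (subst (asm) summable_iff_shift[of "\<lambda>k. \<alpha> k * (h (y k w) - h \<theta>)"])
      with elim show ?case using convergent_ignore_initial_segment[of "\<lambda>k. lyapunov \<theta> k w" k1] by simp
    qed
  qed
  \<comment> \<open>The exceptional null set above depends on \<open>\<theta>\<close>; a countable
    dense set of minimizers keeps the union of these sets null.\<close>
  obtain Q where Q: "countable Q" "Q \<subseteq> minimizers \<Omega> h" "minimizers \<Omega> h \<subseteq> closure Q"
    using separable by blast
  have "AE w in M. \<forall>\<theta>\<in>Q. convergent (\<lambda>k. lyapunov \<theta> k w) \<and> summable (\<lambda>k. \<alpha> k * (h (y k w) - h \<theta>))"
    unfolding AE_ball_countable[OF Q(1)] using Q(2) single by blast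
  moreover have "AE w in M. w \<in> space M" by (rule AE_space)
  ultimately show ?thesis
  proof eventually_elim
    case (elim w)
    note w = elim(2)
    have "continuous_on \<Omega> h"
      unfolding h_def
      by (intro continuous_on_sum continuous_at_imp_continuous_on ballI differentiable_imp_continuous_within diff)
    moreover have "(\<lambda>k. x i k w - y k w) \<longlonglongrightarrow> 0" for i
    proof (rule Lim_null_comparison[OF _ D_lim])
      have "norm (x i k w - y k w) \<le> D k" for k
        using norm_diff_mean_le[of "\<lambda>i. x i k w" i] D(2)[OF w, of k] by (simp add: y_def)
      then show "\<forall>\<^sub>F k in sequentially. norm (x i k w - y k w) \<le> D k" by simp
    qed
    ultimately show ?case
      unfolding h_def[symmetric]
      by (intro fejer_monotone_convergence[where y="\<lambda>k. y k w" and Q=Q and \<alpha>=\<alpha>])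
        (use elim(1) Q min \<Omega> mean_mem[OF w] div less_imp_le[OF \<alpha>] in
          \<open>auto simp: lyapunov_def y_def h_def\<close>)
  qed
qed

end

theorem theorem1:
  fixes \<Omega> :: "(real ^ 'n) set"
    and f :: "'a::finite \<Rightarrow> real ^ 'n \<Rightarrow> real"
    and A :: "real ^ 'a ^ 'a"
    and M :: "'w measure"
    and \<xi> :: "'a \<Rightarrow> nat \<Rightarrow> 'w \<Rightarrow> real ^ 'n"
    and x v g ghat :: "'a \<Rightarrow> nat \<Rightarrow> 'w \<Rightarrow> real ^ 'n"
    and x0 :: "'a \<Rightarrow> real ^ 'n"
    and \<alpha> \<tau> :: "nat \<Rightarrow> real"
    and \<eta> C0 \<delta> \<nu> \<mu> :: real
  assumes "CARD('a) > 1"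
    and "prob_space M"
    \<comment> \<open>communication graph\<close>
    and "doubly_stochastic A"
    and "\<And>i. i \<in> in_neighbours A i"
    and "strongly_connected A"
    and "0 < \<eta>" and "\<eta> < 1"
    and "\<And>i j. j \<in> in_neighbours A i \<Longrightarrow> A $ i $ j \<ge> \<eta>"
    \<comment> \<open>constraint set and objectives\<close>
    and "\<Omega> \<noteq> {}" and "closed \<Omega>" and "convex \<Omega>"
    and "\<And>i \<theta>. \<theta> \<in> \<Omega> \<Longrightarrow> f i differentiable (at \<theta>)"
    and "\<And>i. continuous_on \<Omega> (gradient (f i))"
    and "\<And>i. convex_on \<Omega> (f i)"
    and "0 < C0"
    and "\<And>i \<theta>. \<theta> \<in> \<Omega> \<Longrightarrow> norm (gradient (f i) \<theta>) \<le> C0"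
    and "minimizers \<Omega> (\<lambda>\<theta>. \<Sum>i\<in>UNIV. f i \<theta>) \<noteq> {}"
    and "\<mu> = 0 \<or> (\<mu> > 0 \<and> (\<forall>i. strongly_convex \<mu> (f i)))"
    \<comment> \<open>algorithm\<close>
    and "\<And>i. x0 i \<in> \<Omega>"
    and "\<And>i w. w \<in> space M \<Longrightarrow> x i 0 w = x0 i"
    and "\<And>i k w. w \<in> space M \<Longrightarrow> v i k w = (\<Sum>j\<in>UNIV. A $ i $ j *\<^sub>R x j k w)"
    and "\<And>i k w. w \<in> space M \<Longrightarrow> g i k w = gradient (f i) (v i k w) + \<xi> i k w"
    and "\<And>i k w. w \<in> space M \<Longrightarrow> ghat i k w = clip (\<tau> k) (g i k w)"
    and "\<And>i k w. w \<in> space M \<Longrightarrow>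
           x i (Suc k) w = closest_point \<Omega> (v i k w - \<alpha> k *\<^sub>R ghat i k w)"
    \<comment> \<open>noise\<close>
    and "\<And>i k. \<xi> i k \<in> borel_measurable M"
    and "1 < \<delta>" and "\<delta> \<le> 2" and "0 < \<nu>"
    and "\<And>i k. AE w in M. nn_cond_exp M (noise_past M \<xi> k)
           (\<lambda>w'. ennreal (norm (\<xi> i k w') powr \<delta>)) w \<le> ennreal (\<nu> powr \<delta>)"
    and "\<And>i k. AE w in M. vec_cond_exp M (noise_past M \<xi> k) (\<xi> i k) w = 0"
    \<comment> \<open>step sizes and clipping thresholds\<close>
    and "\<And>k. \<alpha> k > 0" and "\<And>k. \<tau> k > 0"
    and "decseq \<alpha>" and "incseq \<tau>"
    and "\<exists>k1>0. \<forall>k\<ge>k1. \<tau> k \<ge> 2 * C0"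
    and "filterlim (\<lambda>n. \<Sum>k<n. \<alpha> k) at_top sequentially"
    and "summable (\<lambda>k. (\<alpha> k)\<^sup>2)"
    and "(\<lambda>k. \<alpha> k * \<tau> k) \<longlonglongrightarrow> 0"
    and "summable (\<lambda>k. (\<alpha> k)\<^sup>2 * (\<tau> k)\<^sup>2)"
    and "\<exists>\<omega>>0. \<exists>\<omega>'. series_less_infinity (\<lambda>k. \<omega> * \<alpha> k powr \<omega>' - \<mu> * \<alpha> k) \<and>
           summable (\<lambda>k. \<alpha> k powr (2 - \<omega>') * \<tau> k powr (2 - 2 * \<delta>))"
  shows "AE w in M. \<forall>i.
           \<exists>\<theta>\<in>minimizers \<Omega> (\<lambda>\<theta>. \<Sum>i\<in>UNIV. f i \<theta>). (\<lambda>k. x i k w) \<longlonglongrightarrow> \<theta>"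
proof -
  interpret clipped_gradient_projection M \<Omega> f A \<xi> x v g ghat x0 \<alpha> \<tau> C0 \<delta> \<nu> \<mu>
    by (intro clipped_gradient_projection.intro clipped_gradient_projection_axioms.intro) fact+
  obtain k1 where k1: "\<And>k. k \<ge> k1 \<Longrightarrow> 2 * C0 \<le> \<tau> k"
    using \<open>\<exists>k1>0. \<forall>k\<ge>k1. \<tau> k \<ge> 2 * C0\<close> by blast
  obtain \<omega> \<omega>' where \<omega>: "0 < \<omega>" "series_less_infinity (\<lambda>k. \<omega> * \<alpha> k powr \<omega>' - \<mu> * \<alpha> k)"
    "summable (\<lambda>k. \<alpha> k powr (2 - \<omega>') * \<tau> k powr (2 - 2 * \<delta>))"
    using \<open>\<exists>\<omega>>0. \<exists>\<omega>'. series_less_infinity (\<lambda>k. \<omega> * \<alpha> k powr \<omega>' - \<mu> * \<alpha> k) \<and>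
      summable (\<lambda>k. \<alpha> k powr (2 - \<omega>') * \<tau> k powr (2 - 2 * \<delta>))\<close> by blast
  have div: "\<not> summable \<alpha>"
  proof
    assume "summable \<alpha>"
    then have "(\<lambda>n. \<Sum>k<n. \<alpha> k) \<longlonglongrightarrow> suminf \<alpha>" by (rule summable_LIMSEQ)
    with \<open>filterlim (\<lambda>n. \<Sum>k<n. \<alpha> k) at_top sequentially\<close> show False
      using not_tendsto_and_filterlim_at_infinity filterlim_at_top_imp_at_infinity sequentially_bot by blast
  qed
  \<comment> \<open>Here one minimizer serves all agents, which is consensus in the limit and
    implies the claim for each agent.\<close>
  have "AE w in M. \<exists>\<theta>\<in>minimizers \<Omega> (\<lambda>\<theta>. \<Sum>i\<in>UNIV. f i \<theta>). \<forall>i. (\<lambda>k. x i k w) \<longlonglongrightarrow> \<theta>"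
    by (rule AE_converges_to_minimizer[OF
          \<open>minimizers \<Omega> (\<lambda>\<theta>. \<Sum>i\<in>UNIV. f i \<theta>) \<noteq> {}\<close> \<open>decseq \<alpha>\<close> k1 less_imp_le[OF \<open>0 < C0\<close>] div
          \<open>summable (\<lambda>k. (\<alpha> k)\<^sup>2)\<close> \<open>summable (\<lambda>k. (\<alpha> k)\<^sup>2 * (\<tau> k)\<^sup>2)\<close> \<omega>])
  then show ?thesis by eventually_elim blast
qed

end
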